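(* Let $p$ be a prime, $N\in\mathbb N$ and $i_1,\dots,i_N\ge0$ with $i_1+\dots+i_N=1$. Then $\dim\mathrm{Bad}_{\mathbb Z_p}(i_1,\dots,i_N)=N$.
   Context: $|\cdot|_p$ is the $p$-adic absolute value, $\mathbb Z_p$ the ring of $p$-adic integers; $\mathbb Z_p^N$ carries the metric $d(x,y)=\max_s|x_s-y_s|_p$ and $\dim$ is Hausdorff dimension with respect to it. $|\cdot|$ is the ordinary absolute value on $\mathbb Z$. $\mathrm{Bad}_{\mathbb Z_p}(i_1,\dots,i_N)$ is the set of $x=(x_1,\dots,x_N)\in\mathbb Z_p^N$ for which there is $c(x)>0$ such that $$\max\{|qx_1-r_1|_p^{1/(1+i_1)},\dots,|qx_N-r_N|_p^{1/(1+i_N)}\}\ \ge\ c(x)\max\{|r_1|,\dots,|r_N|,|q|\}^{-1}$$ for all $(r_1,\dots,r_N)\in\mathbb Z^N$ and $q\in\mathbb Z\setminus\{0\}$. *)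

theory Defs
  imports "HOL-Analysis.Analysis"
begin

text \<open>A p-adic integer is represented by its coherent sequence of residues:
  x k \<in> {0..<p^k} and x (Suc k) mod p^k = x k (so x k = x mod p^k).\<close>

definition Zp :: "nat \<Rightarrow> (nat \<Rightarrow> int) set" where
  "Zp p = {x. \<forall>k. 0 \<le> x k \<and> x k < int p ^ k \<and> x (Suc k) mod int p ^ k = x k}"

text \<open>p-adic absolute value of an element given by residues y k = y mod p^k:
  |y|_p = p^(-v(y)), v(y) the largest k with p^k dividing y, i.e. the least k with
  y mod p^(k+1) \<noteq> 0; |0|_p = 0.\<close>

definition padic_norm :: "nat \<Rightarrow> (nat \<Rightarrow> int) \<Rightarrow> real" where
  "padic_norm p y = (if \<forall>k. y k = 0 then 0
     else real p powr (- real (LEAST k. y (Suc k) \<noteq> 0)))"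

definition padic_abs_lin :: "nat \<Rightarrow> int \<Rightarrow> (nat \<Rightarrow> int) \<Rightarrow> int \<Rightarrow> real" where
  "padic_abs_lin p q x r = padic_norm p (\<lambda>k. (q * x k - r) mod int p ^ k)"

definition padic_dist :: "nat \<Rightarrow> (nat \<Rightarrow> int) \<Rightarrow> (nat \<Rightarrow> int) \<Rightarrow> real" where
  "padic_dist p x y = padic_norm p (\<lambda>k. (x k - y k) mod int p ^ k)"

definition ZpN :: "nat \<Rightarrow> nat \<Rightarrow> (nat \<Rightarrow> nat \<Rightarrow> int) set" where
  "ZpN p N = {x. (\<forall>s<N. x s \<in> Zp p) \<and> (\<forall>s\<ge>N. x s = (\<lambda>_. 0))}"

definition ZpN_dist :: "nat \<Rightarrow> nat \<Rightarrow> (nat \<Rightarrow> nat \<Rightarrow> int) \<Rightarrow> (nat \<Rightarrow> nat \<Rightarrow> int) \<Rightarrow> real" where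
  "ZpN_dist p N x y = Max ((\<lambda>s. padic_dist p (x s) (y s)) ` {..<N})"

definition diam_d :: "('a \<Rightarrow> 'a \<Rightarrow> real) \<Rightarrow> 'a set \<Rightarrow> real" where
  "diam_d d A = (if A = {} then 0 else Sup {d x y | x y. x \<in> A \<and> y \<in> A})"

definition diam_pow :: "('a \<Rightarrow> 'a \<Rightarrow> real) \<Rightarrow> real \<Rightarrow> 'a set \<Rightarrow> real" where
  "diam_pow d s A = (if A = {} then 0 else if diam_d d A = 0 then (if s = 0 then 1 else 0)
                     else diam_d d A powr s)"

definition hausdorff_content ::
  "'a set \<Rightarrow> ('a \<Rightarrow> 'a \<Rightarrow> real) \<Rightarrow> real \<Rightarrow> real \<Rightarrow> 'a set \<Rightarrow> ennreal" where
  "hausdorff_content X d s \<delta> E =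
     (INF C \<in> {C :: nat \<Rightarrow> 'a set. (\<forall>n. C n \<subseteq> X \<and> diam_d d (C n) \<le> \<delta>) \<and> E \<subseteq> (\<Union>n. C n)}.
        (\<Sum>n. ennreal (diam_pow d s (C n))))"

definition hausdorff_measure ::
  "'a set \<Rightarrow> ('a \<Rightarrow> 'a \<Rightarrow> real) \<Rightarrow> real \<Rightarrow> 'a set \<Rightarrow> ennreal" where
  "hausdorff_measure X d s E = (SUP \<delta> \<in> {0<..}. hausdorff_content X d s \<delta> E)"

definition hausdorff_dim :: "'a set \<Rightarrow> ('a \<Rightarrow> 'a \<Rightarrow> real) \<Rightarrow> 'a set \<Rightarrow> ereal" where
  "hausdorff_dim X d E = (INF s \<in> {s. 0 \<le> s \<and> hausdorff_measure X d s E = 0}. ereal s)"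

definition Bad_Zp :: "nat \<Rightarrow> nat \<Rightarrow> (nat \<Rightarrow> real) \<Rightarrow> (nat \<Rightarrow> nat \<Rightarrow> int) set" where
  "Bad_Zp p N i = {x \<in> ZpN p N. \<exists>c>0. \<forall>(r :: nat \<Rightarrow> int) (q :: int). q \<noteq> 0 \<longrightarrow>
      Max ((\<lambda>s. padic_abs_lin p q (x s) (r s) powr (1 / (1 + i s))) ` {..<N})
        \<ge> c * inverse (real_of_int (Max (insert \<bar>q\<bar> ((\<lambda>s. \<bar>r s\<bar>) ` {..<N}))))}"

end

theory Submission
  imports Defs
begin

text \<open>
  Cover \<open>Z_p^N\<close> by nested boxes whose side in coordinate \<open>s\<close> at level \<open>l\<close> is about
  \<open>P^(-(l + N + 2)(1 + i_s))\<close> with \<open>P = p^K\<close>.  By the pigeonhole principle, a level-\<open>l\<close> box has an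
  integer linear form so small, both in size and modulo a power of \<open>p\<close>, that it vanishes on every
  rational point of height below \<open>P^(l+1)\<close> in the box.  These points thus lie on one
  hyperplane, which meets at most a proportion \<open>1/p\<close> of the child boxes, so at least half of the
  children are free of them; a point all of whose boxes are chosen in this way is badly approximable.

  If the Hausdorff measure of the set in some dimension \<open>\<sigma> < N\<close> were zero, it would be covered by
  balls \<open>B_n\<close> of radius \<open>p^(-k_n)\<close> with \<open>\<Sum> 2^(L_n) p^(-N k_n)\<close> as small as we like, where
  \<open>L_n = k_n div K + 1\<close> is a level at which the boxes are smaller than \<open>B_n\<close>.  Weigh a box by
  \<open>\<Sum> 2^(L_n) vol (B_n \<inter> box)\<close>.  Averaging over the good children, at least half of all, one can descend
  keeping the weight at level \<open>l\<close> below \<open>2^l vol (box)\<close>, which at level \<open>L_n\<close> forces the box to be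
  disjoint from \<open>B_n\<close>.  The limit point is badly approximable and uncovered.
\<close>

subsection \<open>Rational points in a box\<close>

lemma int_div_less:
  fixes x k n :: int
  assumes "0 < k" "x < n * k"
  shows "x div k < n"
proof (rule ccontr)
  assume "\<not> x div k < n"
  then have "n * k \<le> x div k * k" using assms(1) by simp
  also have "\<dots> \<le> x" using assms(1) by (simp add: div_mult_mod_eq minus_mod_eq_div_mult[symmetric])
  finally show False using assms(2) by simp
qed

text \<open>Pigeonhole on the values modulo \<open>p ^ m\<close> of the forms with coefficients in
  \<open>D\<close>: by \<open>big\<close>, \<open>D\<close> has more than \<open>p ^ m\<close>
  elements, and the difference of two forms with equal value is the one sought. The factor
  \<open>p ^ (m - a s)\<close> makes the congruence depend on \<open>V s\<close> only modulo
  \<open>p ^ a s\<close>, so on the box and not on the point chosen in it.\<close>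

lemma linear_form_exists:
  fixes p N h :: nat and a :: "nat \<Rightarrow> nat" and V :: "nat \<Rightarrow> int"
  assumes p: "1 < p" and a: "\<And>s. s < N \<Longrightarrow> h + N \<le> a s"
    and big: "Suc N * (h + N) < (\<Sum>s<N. a s)"
    and m: "m = (\<Sum>s<N. a s)"
  obtains A0 :: int and B :: "nat \<Rightarrow> int" where
    "\<exists>s<N. B s \<noteq> 0"
    "int p ^ m dvd A0 + (\<Sum>s<N. int p ^ (m - a s) * B s * V s)"
    "\<bar>A0\<bar> < int p ^ (m - (h + N))"
    "\<And>s. s < N \<Longrightarrow> \<bar>B s\<bar> < int p ^ (a s - (h + N))"
proof -
  define f where "f = (\<lambda>(A :: int, B :: nat \<Rightarrow> int).
    (A + (\<Sum>s<N. int p ^ (m - a s) * B s * V s)) mod int p ^ m)"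
  define D where "D = {0..<int p ^ (m - (h + N))} \<times>
    PiE {..<N} (\<lambda>s. {0..<int p ^ (a s - (h + N))})"
  have "(\<Sum>s<N. a s - (h + N)) = m - N * (h + N)"
    using a by (subst sum_subtractf_nat) (auto simp: m)
  then have expo: "m < m - (h + N) + (\<Sum>s<N. a s - (h + N))"
    using big by (simp add: m)
  have "card D = p ^ (m - (h + N)) * (\<Prod>s<N. p ^ (a s - (h + N)))"
    by (simp add: D_def card_cartesian_product card_PiE nat_power_eq)
  then have "card D = p ^ (m - (h + N) + (\<Sum>s<N. a s - (h + N)))"
    by (simp add: power_add power_sum)
  then have cardD: "p ^ m < card D"
    using expo p by simp
  have "f ` D \<subseteq> {0..<int p ^ m}"
    using p by (auto simp: f_def)
  then have "\<not> inj_on f D"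
    using card_inj_on_le[of f D "{0..<int p ^ m}"] cardD by (auto simp: nat_power_eq)
  then obtain A B A' B' where AB: "(A, B) \<in> D" "(A', B') \<in> D" "(A, B) \<noteq> (A', B')"
      "f (A, B) = f (A', B')"
    unfolding inj_on_def by auto
  have "int p ^ m dvd (A + (\<Sum>s<N. int p ^ (m - a s) * B s * V s)) -
      (A' + (\<Sum>s<N. int p ^ (m - a s) * B' s * V s))"
    using AB(4) by (simp add: f_def mod_eq_dvd_iff)
  also have "\<dots> = (A - A') + (\<Sum>s<N. int p ^ (m - a s) * (B s - B' s) * V s)"
    by (simp add: left_diff_distrib right_diff_distrib sum_subtractf)
  finally have dvd: "int p ^ m dvd (A - A') + (\<Sum>s<N. int p ^ (m - a s) * (B s - B' s) * V s)" .
  have A: "\<bar>A - A'\<bar> < int p ^ (m - (h + N))"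
  proof -
    have "A \<in> {0..<int p ^ (m - (h + N))}" "A' \<in> {0..<int p ^ (m - (h + N))}"
      using AB(1,2) unfolding D_def by blast+
    then show ?thesis by auto
  qed
  have B: "\<bar>B s - B' s\<bar> < int p ^ (a s - (h + N))" if "s < N" for s
  proof -
    have "B s \<in> {0..<int p ^ (a s - (h + N))}" "B' s \<in> {0..<int p ^ (a s - (h + N))}"
      using AB(1,2) that unfolding D_def by blast+
    then show ?thesis by auto
  qed
  \<comment> \<open>If all these differences vanished, \<open>A - A'\<close> would be a nonzero
    multiple of \<open>p ^ m\<close> of absolute value below \<open>p ^ m\<close>.\<close>
  have "\<exists>s<N. B s - B' s \<noteq> 0"
  proof (rule ccontr)
    assume neg: "\<not> ?thesis"
    then have "B = B'"
      using AB(1,2) by (intro PiE_ext[of B "{..<N}" _ B']) (auto simp: D_def)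
    then have "A - A' \<noteq> 0" "int p ^ m dvd A - A'" using dvd AB(3) by auto
    then have "int p ^ m \<le> \<bar>A - A'\<bar>"
      using dvd_imp_le_int[of "A - A'" "int p ^ m"] by simp
    moreover have "int p ^ (m - (h + N)) \<le> int p ^ m"
      using p by (intro power_increasing) auto
    ultimately show False using A by linarith
  qed
  then show thesis
    by (rule that[OF _ dvd A B])
qed

text \<open>Replacing each \<open>r s\<close> by \<open>q * V s\<close>, which is congruent to it
  modulo \<open>p ^ a s\<close>, shows that the left side is a multiple of \<open>p ^ m\<close>. It
  has \<open>N + 1\<close> summands of size at most \<open>p ^ (m - N)\<close>, the first strictly
  smaller, so its absolute value is below \<open>p ^ m\<close>.\<close>

lemma linear_form_vanishes:
  fixes p N h :: nat and a :: "nat \<Rightarrow> nat" and V B r :: "nat \<Rightarrow> int" and A0 q :: int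
  assumes p: "1 < p" and a: "\<And>s. s < N \<Longrightarrow> h + N \<le> a s"
    and N: "0 < N"
    and m: "m = (\<Sum>s<N. a s)"
    and dvd: "int p ^ m dvd A0 + (\<Sum>s<N. int p ^ (m - a s) * B s * V s)"
    and A0: "\<bar>A0\<bar> < int p ^ (m - (h + N))"
    and B: "\<And>s. s < N \<Longrightarrow> \<bar>B s\<bar> < int p ^ (a s - (h + N))"
    and q: "\<bar>q\<bar> < int p ^ h" and r: "\<And>s. s < N \<Longrightarrow> \<bar>r s\<bar> < int p ^ h"
    and qr: "\<And>s. s < N \<Longrightarrow> int p ^ a s dvd q * V s - r s"
  shows "A0 * q + (\<Sum>s<N. int p ^ (m - a s) * B s * r s) = 0"
proof (rule ccontr)
  let ?F = "A0 * q + (\<Sum>s<N. int p ^ (m - a s) * B s * r s)"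
  assume nz: "?F \<noteq> 0"
  have am: "a s \<le> m" if "s < N" for s
    using that by (auto simp: m intro: member_le_sum)
  have hm: "h + N \<le> m"
    using a[OF N] am[OF N] by simp
  have eq: "?F = q * (A0 + (\<Sum>s<N. int p ^ (m - a s) * B s * V s))
      - (\<Sum>s<N. int p ^ (m - a s) * B s * (q * V s - r s))"
    by (simp add: algebra_simps sum_subtractf sum_distrib_left)
  have "int p ^ m dvd int p ^ (m - a s) * B s * (q * V s - r s)" if "s < N" for s
  proof -
    have "int p ^ (m - a s) * int p ^ a s dvd int p ^ (m - a s) * B s * (q * V s - r s)"
      using qr[OF that] by (intro mult_dvd_mono) auto
    then show ?thesis
      using am[OF that] by (simp flip: power_add)
  qed
  then have "int p ^ m dvd ?F"
    unfolding eq by (intro dvd_diff dvd_sum dvd_mult[OF dvd]) auto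
  then have ge: "int p ^ m \<le> \<bar>?F\<bar>"
    using dvd_imp_le_int[OF nz] by fastforce
  have term_less: "\<bar>x * y\<bar> \<le> int p ^ (m - N)"
    if "\<bar>x\<bar> < int p ^ (m - (h + N))" "\<bar>y\<bar> < int p ^ h" for x y
  proof -
    have "\<bar>x * y\<bar> \<le> int p ^ (m - (h + N)) * int p ^ h"
      unfolding abs_mult using that by (intro mult_mono) auto
    also have "\<dots> = int p ^ (m - N)"
      using hm by (simp flip: power_add)
    finally show ?thesis .
  qed
  have "\<bar>int p ^ (m - a s) * B s * r s\<bar> \<le> int p ^ (m - N)" if s: "s < N" for s
  proof (rule term_less)
    have "\<bar>int p ^ (m - a s) * B s\<bar> < int p ^ (m - a s) * int p ^ (a s - (h + N))"
      using B[OF s] p by (simp add: abs_mult)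
    also have "\<dots> = int p ^ (m - (h + N))"
      using am[OF s] a[OF s] by (simp flip: power_add)
    finally show "\<bar>int p ^ (m - a s) * B s\<bar> < int p ^ (m - (h + N))" .
  qed (use r s in auto)
  then have "\<bar>\<Sum>s<N. int p ^ (m - a s) * B s * r s\<bar> \<le> of_nat (card {..<N}) * int p ^ (m - N)"
    by (intro order.trans[OF sum_abs] sum_bounded_above) auto
  moreover have "\<bar>A0 * q\<bar> < int p ^ (m - N)"
  proof (cases "q = 0")
    case False
    have "\<bar>A0\<bar> * \<bar>q\<bar> < int p ^ (m - (h + N)) * int p ^ h"
      using A0 q False p by (intro mult_strict_mono) auto
    also have "\<dots> = int p ^ (m - N)"
      using hm by (simp flip: power_add)
    finally show ?thesis by (simp add: abs_mult)
  qed (use p in auto)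
  ultimately have "\<bar>?F\<bar> < int (Suc N) * int p ^ (m - N)"
    by (simp add: algebra_simps)
  also have "\<dots> \<le> int p ^ N * int p ^ (m - N)"
  proof (rule mult_right_mono)
    \<comment> \<open>This is the purpose of the margin \<open>N\<close> in \<open>h + N\<close>:
      the factor \<open>p ^ N\<close> gained in the coefficient bounds pays for the
      \<open>N + 1\<close> summands.\<close>
    have "Suc N \<le> 2 ^ N" by (induction N) auto
    also have "\<dots> \<le> p ^ N" using p by (intro power_mono) auto
    finally show "int (Suc N) \<le> int p ^ N"
      by (metis of_nat_le_iff of_nat_power)
  qed auto
  also have "\<dots> = int p ^ m"
    using hm by (simp flip: power_add)
  finally show False using ge by simp
qed

text \<open>\<open>e\<close> is the minimal p-adic valuation among the entries, found as the least
  exponent for which some entry is not divisible by \<open>p ^ Suc e\<close>. It serves for the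
  coefficients of the linear form and, with a single entry, to split the power of \<open>p\<close>
  off a denominator.\<close>

lemma max_prime_power_divisor:
  fixes B :: "nat \<Rightarrow> int"
  assumes p: "1 < p" and B: "t < N" "B t \<noteq> 0"
  obtains e t u where "\<And>s. s < N \<Longrightarrow> int p ^ e dvd B s" "t < N" "B t = int p ^ e * u"
    "\<not> int p dvd u"
proof -
  define P where "P = (\<lambda>e. \<exists>t<N. \<not> int p ^ Suc e dvd B t)"
  have "\<bar>B t\<bar> < int p ^ Suc (nat \<bar>B t\<bar>)"
  proof -
    have "nat \<bar>B t\<bar> < 2 ^ nat \<bar>B t\<bar>" by simp
    also have "\<dots> \<le> p ^ nat \<bar>B t\<bar>" using p by (intro power_mono) auto
    also have "\<dots> \<le> p ^ Suc (nat \<bar>B t\<bar>)" using p by (intro power_increasing) auto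
    finally have "int (nat \<bar>B t\<bar>) < int (p ^ Suc (nat \<bar>B t\<bar>))"
      by (simp only: of_nat_less_iff)
    then show ?thesis by simp
  qed
  then have "\<not> int p ^ Suc (nat \<bar>B t\<bar>) dvd B t"
    using B(2) dvd_imp_le_int[of "B t" "int p ^ Suc (nat \<bar>B t\<bar>)"] by auto
  then have ex: "P (nat \<bar>B t\<bar>)"
    using B(1) by (auto simp: P_def)
  define e where "e = (LEAST e. P e)"
  have "P e" unfolding e_def using ex by (rule LeastI)
  then obtain t' where t': "t' < N" "\<not> int p ^ Suc e dvd B t'"
    by (auto simp: P_def)
  have dvd: "int p ^ e dvd B s" if "s < N" for s
  proof (cases e)
    case (Suc e')
    then have "\<not> P e'" using not_less_Least[of e' P] by (simp add: e_def)
    then show ?thesis using that Suc by (auto simp: P_def)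
  qed auto
  obtain u where u: "B t' = int p ^ e * u" using dvd[OF t'(1)] by auto
  have "\<not> int p dvd u"
    using t'(2) u by (auto simp: mult_ac)
  then show thesis using that dvd t'(1) u by blast
qed

text \<open>Two such points that agree outside \<open>t\<close> have forms differing by
  \<open>p ^ (m + e) * u * (Y t - Z t)\<close>, so \<open>p\<close> divides
  \<open>Y t - Z t\<close>. Hence the lowest base-\<open>p\<close> digit of \<open>Y t\<close> is
  determined by all the other data, and deleting it is injective on \<open>Bs\<close>.\<close>

lemma card_near_hyperplane:
  fixes p N m e :: nat and a d :: "nat \<Rightarrow> nat" and V B :: "nat \<Rightarrow> int" and A0 u :: int
  assumes p: "prime p" and am: "\<And>s. s < N \<Longrightarrow> a s \<le> m" and d: "\<And>s. s < N \<Longrightarrow> 0 < d s"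
    and t: "t < N" and u: "B t = int p ^ e * u" "\<not> int p dvd u"
  defines "Bs \<equiv> {Y \<in> PiE {..<N} (\<lambda>s. {0..<int p ^ d s}).
    int p ^ (m + e + 1) dvd A0 + (\<Sum>s<N. int p ^ (m - a s) * B s * (V s + int p ^ a s * Y s))}"
  shows "card Bs * p \<le> (\<Prod>s<N. p ^ d s)"
proof -
  have p1: "1 < p" using p prime_gt_1_nat by blast
  define g where "g = (\<lambda>Y :: nat \<Rightarrow> int. Y(t := Y t div int p))"
  define R where "R = PiE {..<N} (\<lambda>s. {0..<int p ^ (if s = t then d s - 1 else d s)})"
  have "inj_on g Bs"
  proof (rule inj_onI)
    fix Y Z assume Y: "Y \<in> Bs" and Z: "Z \<in> Bs" and eq: "g Y = g Z"
    have same: "Y s = Z s" if "s \<noteq> t" for s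
      using fun_cong[OF eq, of s] that by (simp add: g_def)
    have divs: "Y t div int p = Z t div int p"
      using fun_cong[OF eq, of t] by (simp add: g_def)
    have "int p ^ (m + e + 1) dvd
      (A0 + (\<Sum>s<N. int p ^ (m - a s) * B s * (V s + int p ^ a s * Y s))) -
      (A0 + (\<Sum>s<N. int p ^ (m - a s) * B s * (V s + int p ^ a s * Z s)))"
      using Y Z by (intro dvd_diff) (auto simp: Bs_def)
    also have "\<dots> = (\<Sum>s<N. int p ^ (m - a s) * B s * int p ^ a s * (Y s - Z s))"
      by (simp add: algebra_simps sum_subtractf sum.distrib)
    also have "\<dots> = (\<Sum>s<N. if s = t then int p ^ (m - a t) * B t * int p ^ a t * (Y t - Z t) else 0)"
      by (intro sum.cong) (auto simp: same)
    also have "\<dots> = int p ^ (m - a t) * B t * int p ^ a t * (Y t - Z t)"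
      using t by simp
    also have "\<dots> = (int p ^ (m - a t) * int p ^ a t) * int p ^ e * (u * (Y t - Z t))"
      by (simp add: u mult_ac)
    also have "int p ^ (m - a t) * int p ^ a t = int p ^ m"
      using am[OF t] by (simp flip: power_add)
    finally have "int p ^ (m + e) * int p dvd int p ^ (m + e) * (u * (Y t - Z t))"
      by (simp add: power_add mult_ac)
    then have "int p dvd u * (Y t - Z t)"
      using p1 by (subst (asm) dvd_mult_cancel_left) auto
    then have "int p dvd Y t - Z t"
      using p u(2) by (simp add: prime_dvd_mult_iff)
    then have "Y t mod int p = Z t mod int p"
      by (simp add: mod_eq_dvd_iff)
    then have "Y t = Z t"
      using divs by (metis div_mult_mod_eq)
    then show "Y = Z" using same by fastforce
  qed
  moreover have "g ` Bs \<subseteq> R"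
  proof clarify
    fix Y assume Y: "Y \<in> Bs"
    have mem: "0 \<le> Y s" "Y s < int p ^ d s" if "s < N" for s
      using Y that by (force simp: Bs_def dest: PiE_mem)+
    have "Y t div int p < int p ^ (d t - 1)"
    proof -
      have "Y t < int p ^ (d t - 1) * int p"
        using mem[OF t] d[OF t] by (simp flip: power_Suc2)
      then show ?thesis
        using p1 by (intro int_div_less) auto
    qed
    then show "g Y \<in> R"
      using mem t Y p1
      by (auto simp: R_def g_def Bs_def PiE_def extensional_def Pi_def pos_imp_zdiv_nonneg_iff)
  qed
  moreover have "finite R" by (auto simp: R_def intro: finite_PiE)
  ultimately have "card Bs \<le> card R" by (intro card_inj_on_le)
  also have "card R = (\<Prod>s<N. p ^ (if s = t then d s - 1 else d s))"
    by (simp add: R_def card_PiE nat_power_eq)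
  finally have "card Bs * p \<le> (\<Prod>s<N. p ^ (if s = t then d s - 1 else d s)) * p"
    by simp
  also have "\<dots> = (\<Prod>s<N. p ^ (if s = t then d s - 1 else d s)) * (\<Prod>s<N. if s = t then p else 1)"
    using t by simp
  also have "\<dots> = (\<Prod>s<N. p ^ d s)"
    unfolding prod.distrib[symmetric] using d by (intro prod.cong) (auto simp flip: power_Suc2)
  finally show ?thesis .
qed

text \<open>One linear form, built from the parent box alone, serves all children. If a child
  contains a rational point of small height, the form vanishes there, which forces the form at the
  base point of the child to be divisible by \<open>p ^ (m + e + 1)\<close>. By
  \<open>card_near_hyperplane\<close> this concerns at most a proportion 1/p of the children, hence
  at most half.\<close>

lemma many_children_without_rational_points:
  fixes p N h :: nat and a a' :: "nat \<Rightarrow> nat" and V :: "nat \<Rightarrow> int"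
  assumes p: "prime p" and N: "0 < N" and a: "\<And>s. s < N \<Longrightarrow> h + N \<le> a s"
    and big: "Suc N * (h + N) < (\<Sum>s<N. a s)"
    and a': "\<And>s. s < N \<Longrightarrow> a s < a' s"
  defines "S \<equiv> PiE {..<N} (\<lambda>s. {0..<int p ^ (a' s - a s)})"
  defines "G \<equiv> {Y \<in> S. \<forall>q r. \<not> int p dvd q \<and> \<bar>q\<bar> < int p ^ h \<and> (\<forall>s<N. \<bar>r s\<bar> < int p ^ h) \<longrightarrow>
    (\<exists>s<N. \<not> int p ^ a' s dvd q * (V s + int p ^ a s * Y s) - r s)}"
  shows "(\<Prod>s<N. p ^ (a' s - a s)) \<le> 2 * card G"
proof -
  have p1: "1 < p" using p prime_gt_1_nat by blast
  define m where "m = (\<Sum>s<N. a s)"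
  have am: "a s \<le> m" if "s < N" for s
    using that by (auto simp: m_def intro: member_le_sum)
  obtain A0 B where AB: "\<exists>s<N. B s \<noteq> 0"
    "int p ^ m dvd A0 + (\<Sum>s<N. int p ^ (m - a s) * B s * V s)"
    "\<bar>A0\<bar> < int p ^ (m - (h + N))"
    "\<And>s. s < N \<Longrightarrow> \<bar>B s\<bar> < int p ^ (a s - (h + N))"
    by (rule linear_form_exists[OF p1 a big m_def, where V = V]) auto
  obtain t0 where t0: "t0 < N" "B t0 \<noteq> 0" using AB(1) by blast
  obtain e t u where e: "\<And>s. s < N \<Longrightarrow> int p ^ e dvd B s" and t: "t < N"
    and u: "B t = int p ^ e * u" "\<not> int p dvd u"
    by (rule max_prime_power_divisor[of p t0 N B, OF p1 t0]) (rule that)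
  define Bs where "Bs = {Y \<in> S.
    int p ^ (m + e + 1) dvd A0 + (\<Sum>s<N. int p ^ (m - a s) * B s * (V s + int p ^ a s * Y s))}"
  have cardBs: "card Bs * p \<le> (\<Prod>s<N. p ^ (a' s - a s))"
    unfolding Bs_def S_def using a' u am by (intro card_near_hyperplane[OF p _ _ t, where u = u]) auto
  have "S - G \<subseteq> Bs"
  proof
    fix Y assume Y: "Y \<in> S - G"
    then obtain q r where qr: "\<not> int p dvd q" "\<bar>q\<bar> < int p ^ h" "\<And>s. s < N \<Longrightarrow> \<bar>r s\<bar> < int p ^ h"
      "\<And>s. s < N \<Longrightarrow> int p ^ a' s dvd q * (V s + int p ^ a s * Y s) - r s"
      by (auto simp: G_def)
    have qV: "int p ^ a s dvd q * V s - r s" if s: "s < N" for s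
    proof -
      have "int p ^ a s dvd q * (V s + int p ^ a s * Y s) - r s"
        using qr(4)[OF s] a'[OF s] by (auto intro: power_le_dvd)
      then have "int p ^ a s dvd (q * (V s + int p ^ a s * Y s) - r s) - int p ^ a s * (q * Y s)"
        by (rule dvd_diff) simp
      then show ?thesis by (simp add: algebra_simps)
    qed
    have vanish: "A0 * q + (\<Sum>s<N. int p ^ (m - a s) * B s * r s) = 0"
      by (rule linear_form_vanishes[OF p1 a N m_def AB(2,3,4) qr(2,3) qV])
    let ?X = "\<lambda>s. V s + int p ^ a s * Y s"
    \<comment> \<open>\<open>B s\<close> supplies \<open>p ^ e\<close>, and the passage from parent
      to child supplies one more factor \<open>p\<close>, because \<open>a s < a' s\<close>.\<close>
    have "int p ^ (m + e + 1) dvd int p ^ (m - a s) * B s * (q * ?X s - r s)" if s: "s < N" for s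
    proof -
      have "int p ^ (m - a s) * int p ^ e * int p ^ Suc (a s)
          dvd int p ^ (m - a s) * B s * (q * ?X s - r s)"
        using e[OF s] power_le_dvd[OF qr(4)[OF s], of "Suc (a s)"] a'[OF s]
        by (intro mult_dvd_mono) auto
      moreover have "m - a s + e + Suc (a s) = m + e + 1" using am[OF s] by simp
      ultimately show ?thesis by (metis power_add)
    qed
    then have "int p ^ (m + e + 1) dvd (\<Sum>s<N. int p ^ (m - a s) * B s * (q * ?X s - r s))"
      by (intro dvd_sum) auto
    also have "\<dots> = q * (A0 + (\<Sum>s<N. int p ^ (m - a s) * B s * ?X s))
       - (A0 * q + (\<Sum>s<N. int p ^ (m - a s) * B s * r s))"
      by (simp add: algebra_simps sum_subtractf sum_distrib_left sum.distrib)
    finally have "int p ^ (m + e + 1) dvd q * (A0 + (\<Sum>s<N. int p ^ (m - a s) * B s * ?X s))"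
      using vanish by simp
    \<comment> \<open>Here it matters that the denominators are prime to \<open>p\<close>:
      \<open>q\<close> can be cancelled.\<close>
    moreover have "coprime (int p ^ (m + e + 1)) q"
      using p qr(1) prime_imp_coprime[of "int p" q] by simp
    ultimately have "int p ^ (m + e + 1) dvd A0 + (\<Sum>s<N. int p ^ (m - a s) * B s * ?X s)"
      using coprime_dvd_mult_right_iff by blast
    then show "Y \<in> Bs"
      using Y unfolding Bs_def by blast
  qed
  moreover have GS: "G \<subseteq> S" unfolding G_def by blast
  moreover have fin: "finite S" by (auto simp: S_def intro: finite_PiE)
  ultimately have "card (S - G) \<le> card Bs"
    by (intro card_mono finite_subset[OF _ fin]) (auto simp: Bs_def)
  moreover have "card S = card G + card (S - G)"
    using card_Un_disjoint[of G "S - G"] finite_subset[OF GS fin] fin GS by (simp add: Un_absorb1)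
  moreover have "card S = (\<Prod>s<N. p ^ (a' s - a s))"
    by (simp add: S_def card_PiE nat_power_eq)
  moreover have "card Bs * 2 \<le> card Bs * p" using p1 by simp
  ultimately show ?thesis using cardBs by linarith
qed

subsection \<open>Descent along light boxes\<close>

text \<open>The Haar measure of the intersection of the balls
  \<open>c + p^k Z_p\<close> and \<open>X + p^a Z_p\<close>.\<close>

definition meet_mass :: "nat \<Rightarrow> nat \<Rightarrow> int \<Rightarrow> nat \<Rightarrow> int \<Rightarrow> real" where
  "meet_mass p k c a X =
     (if int p ^ min k a dvd X - c then 1 / real p ^ max k a else 0)"

lemma meet_mass_nonneg: "0 \<le> meet_mass p k c a X"
  by (simp add: meet_mass_def)

lemma meet_mass_le: "0 < p \<Longrightarrow> meet_mass p k c a X \<le> 1 / real p ^ k"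
  by (auto simp: meet_mass_def intro!: divide_left_mono power_increasing)

lemma card_residue_class_le:
  assumes "0 < p" "j \<le> d"
  shows "card {y \<in> {0..<int p ^ d}. int p ^ j dvd y - z} \<le> p ^ (d - j)"
proof -
  let ?A = "{y \<in> {0..<int p ^ d}. int p ^ j dvd y - z}"
  have "inj_on (\<lambda>y. y div int p ^ j) ?A"
  proof (rule inj_onI)
    fix x y assume "x \<in> ?A" "y \<in> ?A" and eq: "x div int p ^ j = y div int p ^ j"
    then have "x mod int p ^ j = y mod int p ^ j"
      by (metis (mono_tags, lifting) mem_Collect_eq mod_eq_dvd_iff)
    with eq show "x = y" by (metis div_mult_mod_eq)
  qed
  moreover have "(\<lambda>y. y div int p ^ j) ` ?A \<subseteq> {0..<int p ^ (d - j)}"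
  proof clarify
    fix y assume y: "y \<in> {0..<int p ^ d}"
    have "int p ^ d = int p ^ (d - j) * int p ^ j"
      using assms(2) by (simp flip: power_add)
    then show "y div int p ^ j \<in> {0..<int p ^ (d - j)}"
      using y assms(1) by (auto intro!: int_div_less simp: pos_imp_zdiv_nonneg_iff)
  qed
  ultimately have "card ?A \<le> card {0..<int p ^ (d - j)}"
    by (intro card_inj_on_le) auto
  then show ?thesis by (simp add: nat_power_eq)
qed

text \<open>The balls \<open>X + p^a y + p^(a+d) Z_p\<close> partition \<open>X + p^a Z_p\<close>,
  so this comes from the additivity of Haar measure. The proof counts the \<open>y\<close> whose
  ball meets the ball around \<open>c\<close>.\<close>

lemma sum_meet_mass_le:
  assumes p: "0 < p"
  shows "(\<Sum>y\<in>{0..<int p ^ d}. meet_mass p k c (a + d) (X + int p ^ a * y)) \<le> meet_mass p k c a X"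
proof (cases "int p ^ min k a dvd X - c")
  case False
  have "\<not> int p ^ min k (a + d) dvd X + int p ^ a * y - c" for y
  proof
    assume "int p ^ min k (a + d) dvd X + int p ^ a * y - c"
    then have "int p ^ min k a dvd X + int p ^ a * y - c"
      by (rule power_le_dvd) auto
    moreover have "int p ^ min k a dvd int p ^ a * y"
      by (intro dvd_mult2 le_imp_power_dvd) auto
    ultimately have "int p ^ min k a dvd (X + int p ^ a * y - c) - int p ^ a * y"
      by (rule dvd_diff)
    then show False using False by simp
  qed
  then show ?thesis by (simp add: meet_mass_def)
next
  case True
  \<comment> \<open>\<open>j\<close> is the number of base-\<open>p\<close> digits of
    \<open>y\<close> that meeting the ball around \<open>c\<close> prescribes: none if that ball
    contains the parent, otherwise \<open>k - a\<close>, capped by the \<open>d\<close> digits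
    available.\<close>
  define j where "j = (if k \<le> a then 0 else min (k - a) d)"
  obtain z where z: "k \<le> a \<or> X - c = int p ^ a * z"
    using True by (cases "k \<le> a") (auto simp: dvd_def)
  have sub: "{y \<in> {0..<int p ^ d}. int p ^ min k (a + d) dvd X + int p ^ a * y - c}
      \<subseteq> {y \<in> {0..<int p ^ d}. int p ^ j dvd y - (- z)}"
  proof clarify
    fix y assume dvd: "int p ^ min k (a + d) dvd X + int p ^ a * y - c"
    show "int p ^ j dvd y - (- z)"
    proof (cases "k \<le> a")
      case False
      then have "X + int p ^ a * y - c = int p ^ a * (y - (- z))"
        using z by (simp add: algebra_simps)
      moreover have "int p ^ min k (a + d) = int p ^ a * int p ^ j"
        using False by (simp add: j_def flip: power_add) (simp add: min_def, linarith)
      ultimately show ?thesis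
        using dvd p by simp
    qed (simp add: j_def)
  qed
  have "card {y \<in> {0..<int p ^ d}. int p ^ min k (a + d) dvd X + int p ^ a * y - c} \<le> p ^ (d - j)"
    by (rule order.trans[OF card_mono[OF finite_subset[of _ "{0..<int p ^ d}"] sub] card_residue_class_le])
      (use p in \<open>auto simp: j_def\<close>)
  then have card: "real (card {y \<in> {0..<int p ^ d}. int p ^ min k (a + d) dvd X + int p ^ a * y - c})
      \<le> real p ^ (d - j)"
    by (metis of_nat_le_iff of_nat_power)
  have "(\<Sum>y\<in>{0..<int p ^ d}. meet_mass p k c (a + d) (X + int p ^ a * y))
    = real (card {y \<in> {0..<int p ^ d}. int p ^ min k (a + d) dvd X + int p ^ a * y - c})
      * (1 / real p ^ max k (a + d))"
    by (simp add: meet_mass_def flip: sum.inter_filter)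
  also have "\<dots> \<le> real p ^ (d - j) * (1 / real p ^ max k (a + d))"
    using card by (intro mult_right_mono) auto
  also have "\<dots> = 1 / real p ^ max k a"
  proof -
    have "max k (a + d) = (d - j) + max k a"
      by (auto simp: j_def max_def min_def)
    then show ?thesis using p by (simp add: power_add)
  qed
  also have "\<dots> = meet_mass p k c a X"
    using True by (simp add: meet_mass_def)
  finally show ?thesis .
qed

lemma sum_prod_meet_mass_le:
  fixes a a' :: "nat \<Rightarrow> nat"
  assumes p: "0 < p" and a: "\<And>s. s < N \<Longrightarrow> a s \<le> a' s"
  shows "(\<Sum>Y\<in>PiE {..<N} (\<lambda>s. {0..<int p ^ (a' s - a s)}).
      \<Prod>s<N. meet_mass p k (c s) (a' s) (X s + int p ^ a s * Y s))
    \<le> (\<Prod>s<N. meet_mass p k (c s) (a s) (X s))"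
proof -
  have "(\<Sum>Y\<in>PiE {..<N} (\<lambda>s. {0..<int p ^ (a' s - a s)}).
      \<Prod>s<N. meet_mass p k (c s) (a' s) (X s + int p ^ a s * Y s))
    = (\<Prod>s<N. \<Sum>y\<in>{0..<int p ^ (a' s - a s)}. meet_mass p k (c s) (a' s) (X s + int p ^ a s * y))"
    by (subst prod_sum_PiE) auto
  also have "\<dots> \<le> (\<Prod>s<N. meet_mass p k (c s) (a s) (X s))"
  proof (intro prod_mono conjI sum_nonneg meet_mass_nonneg)
    fix s assume "s \<in> {..<N}"
    then have "a s + (a' s - a s) = a' s" using a by simp
    then show "(\<Sum>y\<in>{0..<int p ^ (a' s - a s)}. meet_mass p k (c s) (a' s) (X s + int p ^ a s * y))
        \<le> meet_mass p k (c s) (a s) (X s)"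
      using sum_meet_mass_le[OF p, where d = "a' s - a s" and k = k and c = "c s" and a = "a s" and X = "X s"]
      by simp
  qed
  finally show ?thesis .
qed

text \<open>Averaging: the good children together weigh at most as much as the parent and fill at
  least half of its volume. If each weighed at least \<open>2 * \<theta>\<close> times its volume,
  the parent would weigh at least \<open>\<theta>\<close> times its own.\<close>

lemma good_light_child_exists:
  fixes a a' :: "nat \<Rightarrow> nat" and k :: "nat \<Rightarrow> nat" and c :: "nat \<Rightarrow> nat \<Rightarrow> int" and w :: "nat \<Rightarrow> real"
  assumes p: "0 < p" and a: "\<And>s. s < N \<Longrightarrow> a s \<le> a' s"
    and G: "G \<subseteq> PiE {..<N} (\<lambda>s. {0..<int p ^ (a' s - a s)})"
    and card: "(\<Prod>s<N. p ^ (a' s - a s)) \<le> 2 * card G"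
    and w: "\<And>n. 0 \<le> w n" and \<theta>: "0 \<le> \<theta>"
    and W: "(\<Sum>n. ennreal (w n * (\<Prod>s<N. meet_mass p (k n) (c n s) (a s) (X s))))
      < ennreal (\<theta> / real p ^ (\<Sum>s<N. a s))"
  shows "\<exists>Y\<in>G. (\<Sum>n. ennreal (w n * (\<Prod>s<N. meet_mass p (k n) (c n s) (a' s) (X s + int p ^ a s * Y s))))
      < ennreal (2 * \<theta> / real p ^ (\<Sum>s<N. a' s))"
proof (rule ccontr)
  let ?m = "\<lambda>Y n. \<Prod>s<N. meet_mass p (k n) (c n s) (a' s) (X s + int p ^ a s * Y s)"
  assume "\<not> ?thesis"
  then have heavy: "ennreal (2 * \<theta> / real p ^ (\<Sum>s<N. a' s)) \<le> (\<Sum>n. ennreal (w n * ?m Y n))"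
    if "Y \<in> G" for Y
    using that by (auto simp: not_less)
  have m0: "0 \<le> ?m Y n" for Y n
    by (intro prod_nonneg) (auto simp: meet_mass_nonneg)
  have "(\<Sum>s<N. a' s) = (\<Sum>s<N. a s) + (\<Sum>s<N. a' s - a s)"
    using a by (simp flip: sum.distrib)
  then have "\<theta> / real p ^ (\<Sum>s<N. a s)
      = \<theta> * real (\<Prod>s<N. p ^ (a' s - a s)) / real p ^ (\<Sum>s<N. a' s)"
    using p by (simp add: power_add power_sum)
  also have "\<dots> \<le> \<theta> * real (2 * card G) / real p ^ (\<Sum>s<N. a' s)"
    using card \<theta> by (intro divide_right_mono mult_left_mono of_nat_mono) auto
  also have "\<dots> = real (card G) * (2 * \<theta> / real p ^ (\<Sum>s<N. a' s))"
    by simp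
  finally have "ennreal (\<theta> / real p ^ (\<Sum>s<N. a s))
      \<le> of_nat (card G) * ennreal (2 * \<theta> / real p ^ (\<Sum>s<N. a' s))"
    using \<theta> by (simp add: ennreal_of_nat_eq_real_of_nat ennreal_leI flip: ennreal_mult)
  also have "\<dots> = (\<Sum>Y\<in>G. ennreal (2 * \<theta> / real p ^ (\<Sum>s<N. a' s)))"
    by simp
  also have "\<dots> \<le> (\<Sum>Y\<in>G. \<Sum>n. ennreal (w n * ?m Y n))"
    using heavy by (rule sum_mono)
  also have "\<dots> = (\<Sum>n. \<Sum>Y\<in>G. ennreal (w n * ?m Y n))"
    by (rule suminf_sum[symmetric]) auto
  also have "\<dots> \<le> (\<Sum>n. ennreal (w n * (\<Prod>s<N. meet_mass p (k n) (c n s) (a s) (X s))))"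
  proof (intro suminf_le summableI)
    fix n
    have "(\<Sum>Y\<in>G. ?m Y n) \<le> (\<Sum>Y\<in>PiE {..<N} (\<lambda>s. {0..<int p ^ (a' s - a s)}). ?m Y n)"
      using G m0 by (intro sum_mono2 finite_PiE) auto
    also have "\<dots> \<le> (\<Prod>s<N. meet_mass p (k n) (c n s) (a s) (X s))"
      by (rule sum_prod_meet_mass_le[OF p a])
    finally have "w n * (\<Sum>Y\<in>G. ?m Y n) \<le> w n * (\<Prod>s<N. meet_mass p (k n) (c n s) (a s) (X s))"
      using w by (rule mult_left_mono)
    then show "(\<Sum>Y\<in>G. ennreal (w n * ?m Y n))
        \<le> ennreal (w n * (\<Prod>s<N. meet_mass p (k n) (c n s) (a s) (X s)))"
      using w m0 by (subst sum_ennreal) (auto simp: sum_distrib_left intro: ennreal_leI)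
  qed
  finally show False using W by simp
qed

lemma good_branch_avoiding_balls:
  fixes a :: "nat \<Rightarrow> nat \<Rightarrow> nat" and Good :: "nat \<Rightarrow> (nat \<Rightarrow> int) \<Rightarrow> bool"
  assumes p: "0 < p" and a: "\<And>l s. s < N \<Longrightarrow> a l s \<le> a (Suc l) s"
    and many: "\<And>l X. (\<Prod>s<N. p ^ (a (Suc l) s - a l s)) \<le>
      2 * card {Y \<in> PiE {..<N} (\<lambda>s. {0..<int p ^ (a (Suc l) s - a l s)}).
        Good l (\<lambda>s. X s + int p ^ a l s * Y s)}"
    and small: "(\<Sum>n. ennreal (2 ^ L n / real p ^ (N * k n))) < ennreal (1 / real p ^ (\<Sum>s<N. a 0 s))"
    and kL: "\<And>n s. s < N \<Longrightarrow> k n \<le> a (L n) s"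
  obtains X where "\<And>l. Good l (X (Suc l))"
    "\<And>l s. s < N \<Longrightarrow> int p ^ a l s dvd X (Suc l) s - X l s"
    "\<And>n. \<exists>s<N. \<not> int p ^ k n dvd X (L n) s - c n s"
proof -
  define W where "W = (\<lambda>l X. \<Sum>n. ennreal (2 ^ L n * (\<Prod>s<N. meet_mass p (k n) (c n s) (a l s) (X s))))"
  define P where "P = (\<lambda>l X. W l X < ennreal (2 ^ l / real p ^ (\<Sum>s<N. a l s)))"
  define Q where "Q = (\<lambda>l X X'. Good l X' \<and> (\<forall>s<N. int p ^ a l s dvd X' s - X s))"
  have "W 0 (\<lambda>_. 0) \<le> (\<Sum>n. ennreal (2 ^ L n / real p ^ (N * k n)))"
    unfolding W_def
  proof (intro suminf_le summableI ennreal_leI)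
    fix n
    have "(\<Prod>s<N. meet_mass p (k n) (c n s) (a 0 s) 0) \<le> (\<Prod>s<N. 1 / real p ^ k n)"
      using p by (intro prod_mono conjI meet_mass_nonneg meet_mass_le)
    also have "\<dots> = 1 / real p ^ (N * k n)"
      by (simp add: power_mult[symmetric] power_one_over mult.commute)
    finally have "2 ^ L n * (\<Prod>s<N. meet_mass p (k n) (c n s) (a 0 s) 0) \<le> 2 ^ L n * (1 / real p ^ (N * k n))"
      by (rule mult_left_mono) auto
    then show "2 ^ L n * (\<Prod>s<N. meet_mass p (k n) (c n s) (a 0 s) 0) \<le> 2 ^ L n / real p ^ (N * k n)"
      by simp
  qed
  \<comment> \<open>The descent starts at the box around 0, of which no goodness is demanded:
    \<open>Good l\<close> concerns the child at level \<open>l + 1\<close>.\<close>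
  then have base: "P 0 (\<lambda>_. 0)"
    using small by (simp add: P_def)
  have step: "\<exists>X'. P (Suc l) X' \<and> Q l X X'" if "P l X" for l X
  proof -
    let ?G = "{Y \<in> PiE {..<N} (\<lambda>s. {0..<int p ^ (a (Suc l) s - a l s)}).
        Good l (\<lambda>s. X s + int p ^ a l s * Y s)}"
    have "\<exists>Y\<in>?G. (\<Sum>n. ennreal (2 ^ L n *
        (\<Prod>s<N. meet_mass p (k n) (c n s) (a (Suc l) s) (X s + int p ^ a l s * Y s))))
      < ennreal (2 * 2 ^ l / real p ^ (\<Sum>s<N. a (Suc l) s))"
      using that unfolding P_def W_def
      by (intro good_light_child_exists[OF p a _ many]) auto
    then obtain Y where "Y \<in> ?G" "P (Suc l) (\<lambda>s. X s + int p ^ a l s * Y s)"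
      by (auto simp: P_def W_def)
    then show ?thesis
      by (intro exI[of _ "\<lambda>s. X s + int p ^ a l s * Y s"]) (auto simp: Q_def)
  qed
  obtain X where X: "\<And>l. P l (X l)" "\<And>l. Q l (X l) (X (Suc l))"
    using dependent_nat_choice[of P Q] base step by blast
  show thesis
  proof (rule that[of X])
    fix n
    show "\<exists>s<N. \<not> int p ^ k n dvd X (L n) s - c n s"
    proof (rule ccontr)
      assume "\<not> ?thesis"
      \<comment> \<open>By \<open>kL\<close> the box is no larger than the ball, so meeting it means
        lying inside. The \<open>n\<close>-th term alone is then \<open>2 ^ L n\<close> times the
        volume of the box, the value that \<open>P\<close> excludes.\<close>
      then have "meet_mass p (k n) (c n s) (a (L n) s) (X (L n) s) = 1 / real p ^ a (L n) s" if "s < N" for s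
        using that kL[OF that, of n] by (auto simp: meet_mass_def min_absorb1 max_absorb2)
      then have "(\<Prod>s<N. meet_mass p (k n) (c n s) (a (L n) s) (X (L n) s)) = (\<Prod>s<N. 1 / real p ^ a (L n) s)"
        by (intro prod.cong) auto
      also have "\<dots> = 1 / real p ^ (\<Sum>s<N. a (L n) s)"
        by (simp add: power_sum prod_dividef)
      finally have "ennreal (2 ^ L n / real p ^ (\<Sum>s<N. a (L n) s))
          = ennreal (2 ^ L n * (\<Prod>s<N. meet_mass p (k n) (c n s) (a (L n) s) (X (L n) s)))"
        by simp
      also have "\<dots> \<le> W (L n) (X (L n))"
        unfolding W_def
        using sum_le_suminf[of "\<lambda>j. ennreal (2 ^ L j * (\<Prod>s<N. meet_mass p (k j) (c j s) (a (L n) s) (X (L n) s)))" "{n}"]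
        by auto
      finally show False
        using X(1)[of "L n"] by (simp add: P_def)
    qed
  qed (use X(2) in \<open>auto simp: Q_def\<close>)
qed

subsection \<open>The p-adic integers\<close>

lemma Zp_mod:
  assumes "x \<in> Zp p" "j \<le> k"
  shows "x k mod int p ^ j = x j"
  using assms(2)
proof (induction k rule: dec_induct)
  case base
  then show ?case using assms(1) by (auto simp: Zp_def)
next
  case (step k)
  have "x (Suc k) mod int p ^ j = x (Suc k) mod int p ^ k mod int p ^ j"
    using step.hyps by (simp add: mod_mod_cancel le_imp_power_dvd)
  then show ?case using step.IH assms(1) by (auto simp: Zp_def)
qed

lemma Zp_eq_iff_dvd:
  assumes "x \<in> Zp p" "y \<in> Zp p"
  shows "x k = y k \<longleftrightarrow> (x k - y k) mod int p ^ k = 0"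
proof -
  have "x k mod int p ^ k = x k" "y k mod int p ^ k = y k"
    using assms by (auto intro: Zp_mod)
  then show ?thesis by (metis mod_eq_dvd_iff dvd_eq_mod_eq_0)
qed

lemma limit_of_nested_boxes:
  assumes p: "0 < p"
    and a: "\<And>l s. s < N \<Longrightarrow> a l s \<le> a (Suc l) s" "\<And>l s. s < N \<Longrightarrow> l \<le> a l s"
    and X: "\<And>l s. s < N \<Longrightarrow> int p ^ a l s dvd X (Suc l) s - X l s"
  obtains x where "x \<in> ZpN p N" "\<And>l s. s < N \<Longrightarrow> int p ^ a l s dvd x s (a l s) - X l s"
proof -
  have nest: "int p ^ a l s dvd X l' s - X l s" if "s < N" "l \<le> l'" for l l' s
    using that(2)
  proof (induction l' rule: dec_induct)
    case (step l')
    have "a l s \<le> a l' s"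
      using a(1)[OF that(1)] step.hyps(1) by (rule lift_Suc_mono_le)
    then have "int p ^ a l s dvd X (Suc l') s - X l' s"
      using X[OF that(1)] by (rule power_le_dvd[rotated])
    then have "int p ^ a l s dvd (X (Suc l') s - X l' s) + (X l' s - X l s)"
      using step.IH by (rule dvd_add)
    then show ?case by simp
  qed simp
  \<comment> \<open>A diagonal choice: as \<open>k \<le> a k s\<close>, all boxes from level
    \<open>k\<close> on share this residue modulo \<open>p ^ k\<close>, so the sequence is
    coherent.\<close>
  define x where "x = (\<lambda>s k. if s < N then X k s mod int p ^ k else 0)"
  have "x s \<in> Zp p" if "s < N" for s
  proof -
    have "X (Suc k) s mod int p ^ Suc k mod int p ^ k = X k s mod int p ^ k" for k
    proof -
      have "int p ^ k dvd X (Suc k) s - X k s"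
        using X[OF that] a(2)[OF that] by (rule power_le_dvd)
      then have "X (Suc k) s mod int p ^ k = X k s mod int p ^ k"
        by (simp add: mod_eq_dvd_iff)
      then show ?thesis by (simp add: mod_mod_cancel le_imp_power_dvd)
    qed
    then show ?thesis using p that by (auto simp: Zp_def x_def)
  qed
  then have "x \<in> ZpN p N"
    by (auto simp: ZpN_def) (auto simp: x_def)
  moreover have "int p ^ a l s dvd x s (a l s) - X l s" if "s < N" for l s
  proof -
    have "x s (a l s) mod int p ^ a l s = X (a l s) s mod int p ^ a l s"
      using that by (simp add: x_def)
    also have "\<dots> = X l s mod int p ^ a l s"
      using nest[OF that a(2)[OF that]] by (simp add: mod_eq_dvd_iff)
    finally show ?thesis by (simp add: mod_eq_dvd_iff)
  qed
  ultimately show thesis by (rule that)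
qed

section \<open>Estimates for the p-adic absolute value and the metric\<close>

lemma padic_norm_nonneg: "0 \<le> padic_norm p y"
  by (simp add: padic_norm_def)

lemma padic_norm_le_1: "0 < p \<Longrightarrow> padic_norm p y \<le> 1"
  by (cases "p = 1") (auto simp: padic_norm_def powr_le_one_le powr_mono[of _ 0 "real p", simplified])

lemma padic_norm_ge:
  assumes "0 < p" "y (Suc b) \<noteq> 0"
  shows "real p powr - real b \<le> padic_norm p y"
proof -
  have "(LEAST k. y (Suc k) \<noteq> 0) \<le> b"
    using assms(2) by (rule Least_le)
  then show ?thesis
    using assms by (auto simp: padic_norm_def intro!: powr_mono)
qed

lemma padic_norm_le:
  assumes "0 < p" "\<And>j. j \<le> k \<Longrightarrow> y j = 0"
  shows "padic_norm p y \<le> real p powr - real k"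
proof (cases "\<forall>j. y j = 0")
  case False
  then obtain j where "y (Suc j) \<noteq> 0"
    using assms(2)[of 0] by (metis le0 not0_implies_Suc)
  then have "y (Suc (LEAST j. y (Suc j) \<noteq> 0)) \<noteq> 0"
    by (rule LeastI)
  then have "k \<le> (LEAST j. y (Suc j) \<noteq> 0)"
    using assms(2) not_less_eq_eq by blast
  then show ?thesis
    using assms(1) False by (auto simp: padic_norm_def intro!: powr_mono)
qed (simp add: padic_norm_def)

text \<open>Failure of divisibility by \<open>p ^ b\<close> bounds the valuation by
  \<open>b - 1\<close>. The one gained here later absorbs the rounding up in the sides of the
  boxes.\<close>

lemma padic_abs_lin_ge:
  assumes "0 < p" "\<not> int p ^ b dvd q * x b - r"
  shows "real p powr (1 - real b) \<le> padic_abs_lin p q x r"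
proof (cases b)
  case (Suc b')
  then have "real p powr - real b' \<le> padic_abs_lin p q x r"
    unfolding padic_abs_lin_def using assms by (intro padic_norm_ge) (auto simp: dvd_eq_mod_eq_0)
  then show ?thesis using Suc by simp
qed (use assms in auto)

lemma ZpN_dist_ge:
  assumes "0 < p" "s < N" "x \<in> ZpN p N" "y \<in> ZpN p N" "x s (Suc k) \<noteq> y s (Suc k)"
  shows "real p powr - real k \<le> ZpN_dist p N x y"
proof -
  have "real p powr - real k \<le> padic_dist p (x s) (y s)"
    unfolding padic_dist_def using assms
    by (intro padic_norm_ge) (auto simp: ZpN_def Zp_eq_iff_dvd)
  also have "\<dots> \<le> ZpN_dist p N x y"
    unfolding ZpN_dist_def using assms(2) by (intro Max_ge) auto
  finally show ?thesis .
qed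

lemma ZpN_dist_le:
  assumes "0 < p" "0 < N" "x \<in> ZpN p N" "y \<in> ZpN p N" "\<And>s. s < N \<Longrightarrow> x s k = y s k"
  shows "ZpN_dist p N x y \<le> real p powr - real k"
proof -
  have "padic_dist p (x s) (y s) \<le> real p powr - real k" if "s < N" for s
    unfolding padic_dist_def
  proof (rule padic_norm_le)
    fix j assume "j \<le> k"
    then have "x s j = y s j"
      using Zp_mod[of "x s" p j k] Zp_mod[of "y s" p j k] assms(3-5) that by (simp add: ZpN_def)
    then show "(x s j - y s j) mod int p ^ j = 0" by simp
  qed (use assms in auto)
  then show ?thesis
    unfolding ZpN_dist_def using assms(2) by (subst Max_le_iff) auto
qed

lemma ZpN_dist_bounds:
  assumes "0 < p" "0 < N"
  shows "0 \<le> ZpN_dist p N x y" "ZpN_dist p N x y \<le> 1"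
  unfolding ZpN_dist_def padic_dist_def using assms
  by (subst Max_ge_iff, auto simp: padic_norm_nonneg) (subst Max_le_iff, auto simp: padic_norm_le_1)

subsection \<open>Badly approximable points outside small balls\<close>

text \<open>Write \<open>q = p^j q'\<close> with \<open>q'\<close> prime to \<open>p\<close>. If
  \<open>p ^ j\<close> fails to divide some \<open>r s\<close>, the bound
  \<open>p ^ j \<le> \<bar>q\<bar>\<close> suffices. Otherwise dividing by \<open>p ^ j\<close>
  reduces to \<open>q'\<close>, and \<open>avoid\<close> applies at the level \<open>l\<close> whose
  range from \<open>p ^ (K * l)\<close> to \<open>p ^ (K * (l + 1))\<close> contains the reduced
  height.\<close>

lemma bad_if_avoids_rational_points:
  fixes p N K :: nat and a :: "nat \<Rightarrow> nat \<Rightarrow> nat" and i :: "nat \<Rightarrow> real"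
  assumes p: "prime p" and N: "0 < N" and K: "0 < K" and i: "\<And>s. s < N \<Longrightarrow> 0 \<le> i s"
    and x: "x \<in> ZpN p N"
    and a: "\<And>l s. s < N \<Longrightarrow> real (a (Suc l) s) \<le> real (K * (l + N + 3)) * (1 + i s) + 1"
    and avoid: "\<And>l q r. \<not> int p dvd q \<Longrightarrow> \<bar>q\<bar> < int p ^ (K * (l + 1)) \<Longrightarrow>
      (\<And>s. s < N \<Longrightarrow> \<bar>r s\<bar> < int p ^ (K * (l + 1))) \<Longrightarrow>
      \<exists>s<N. \<not> int p ^ a (Suc l) s dvd q * x s (a (Suc l) s) - r s"
  shows "x \<in> Bad_Zp p N i"
proof -
  have p1: "1 < p" using p prime_gt_1_nat by blast
  \<comment> \<open>The ratio of \<open>p ^ (K * l)\<close>, the least height treated at level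
    \<open>l\<close>, to \<open>p ^ (K * (l + N + 3))\<close>, which governs the sides of the boxes
    at level \<open>l + 1\<close>.\<close>
  define c where "c = real p powr - real (K * (N + 3))"
  have c0: "0 < c" using p1 by (simp add: c_def)
  have "c * inverse (real_of_int (Max (insert \<bar>q\<bar> ((\<lambda>s. \<bar>r s\<bar>) ` {..<N}))))
      \<le> Max ((\<lambda>s. padic_abs_lin p q (x s) (r s) powr (1 / (1 + i s))) ` {..<N})"
    if q: "q \<noteq> 0" for r :: "nat \<Rightarrow> int" and q :: int
  proof -
    define H where "H = Max (insert \<bar>q\<bar> ((\<lambda>s. \<bar>r s\<bar>) ` {..<N}))"
    have Hq: "\<bar>q\<bar> \<le> H" unfolding H_def by (rule Max_ge) auto
    have Hr: "\<bar>r s\<bar> \<le> H" if "s < N" for s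
      unfolding H_def using that by (intro Max_ge) auto
    have H0: "0 < H" using Hq q by linarith
    obtain j q' where q': "q = int p ^ j * q'" "\<not> int p dvd q'"
      by (rule max_prime_power_divisor[of p 0 1 "\<lambda>_. q", OF p1]) (use q that in auto)
    \<comment> \<open>The common form of both cases: the absolute value in coordinate
      \<open>s\<close> is at least \<open>p powr (1 - b)\<close>, so its root of order
      \<open>1 + i s\<close> is at least \<open>p powr - M\<close>, and the last conjunct compares
      this with \<open>c / H\<close>.\<close>
    have "\<exists>s b M. s < N \<and> \<not> int p ^ b dvd q * x s b - r s \<and> real b - 1 \<le> M * (1 + i s)
        \<and> c * real p powr M \<le> H"
    proof (cases "\<exists>s<N. \<not> int p ^ j dvd r s")
      case True
      then obtain s where s: "s < N" "\<not> int p ^ j dvd r s" by blast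
      have ndvd: "\<not> int p ^ j dvd q * x s j - r s"
      proof
        assume "int p ^ j dvd q * x s j - r s"
        then have "int p ^ j dvd q * x s j - (q * x s j - r s)"
          by (rule dvd_diff[rotated]) (simp add: q')
        then show False using s(2) by simp
      qed
      have le: "real j - 1 \<le> real j * (1 + i s)"
        using i[OF s(1)] by (simp add: algebra_simps add_increasing2)
      have "int p ^ j \<le> \<bar>q\<bar>"
        using q dvd_imp_le_int[OF q, of "int p ^ j"] by (simp add: q'(1))
      then have "int p ^ j \<le> H" using Hq by linarith
      then have "real p ^ j \<le> H"
        by (metis of_int_le_iff of_int_of_nat_eq of_int_power)
      moreover have "c \<le> 1"
        using p1 by (auto simp: c_def powr_minus intro!: inverse_le_1_iff[THEN iffD2] disjI2 ge_one_powr_ge_zero)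
      then have "c * real p ^ j \<le> 1 * real p ^ j"
        by (rule mult_right_mono) auto
      ultimately have "c * real p ^ j \<le> H" by linarith
      then have "c * real p powr real j \<le> H"
        using p1 by (simp add: powr_realpow)
      then show ?thesis using s(1) ndvd le by blast
    next
      case False
      define r' where "r' = (\<lambda>s. r s div int p ^ j)"
      have r': "r s = int p ^ j * r' s" if "s < N" for s
        using False that by (simp add: r'_def)
      define H' where "H' = H div int p ^ j"
      have H'le: "\<bar>y\<bar> \<le> H'" if "\<bar>int p ^ j * y\<bar> \<le> H" for y
      proof -
        have "int p ^ j * \<bar>y\<bar> \<le> H" using that by (simp add: abs_mult)
        then have "(int p ^ j * \<bar>y\<bar>) div int p ^ j \<le> H'"
          unfolding H'_def using p1 by (intro zdiv_mono1) auto
        then show ?thesis using p1 by simp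
      qed
      have q'H: "\<bar>q'\<bar> \<le> H'" using H'le Hq q'(1) by blast
      have H'1: "1 \<le> H'" using q'H q'(2) by (cases "q' = 0") auto
      define l where "l = (LEAST l. H' < int p ^ (K * (l + 1)))"
      have "H' < int p ^ (K * (nat H' + 1))"
      proof -
        have "nat H' < 2 ^ nat H'" by simp
        also have "\<dots> \<le> p ^ nat H'" using p1 by (intro power_mono) auto
        also have "\<dots> \<le> p ^ (K * (nat H' + 1))" using p1 K by (intro power_increasing) (cases K, auto)
        finally have "int (nat H') < int (p ^ (K * (nat H' + 1)))" by (simp only: of_nat_less_iff)
        then show ?thesis using H'1 by simp
      qed
      then have l: "H' < int p ^ (K * (l + 1))" unfolding l_def by (rule LeastI)
      have l': "int p ^ (K * l) \<le> H'"
      proof (cases l)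
        case (Suc l0)
        then have "\<not> H' < int p ^ (K * (l0 + 1))"
          using not_less_Least[of l0 "\<lambda>l. H' < int p ^ (K * (l + 1))"] by (simp add: l_def)
        then show ?thesis using Suc by simp
      qed (use H'1 in simp)
      have "\<exists>s<N. \<not> int p ^ a (Suc l) s dvd q' * x s (a (Suc l) s) - r' s"
      proof (rule avoid[OF q'(2)])
        show "\<bar>q'\<bar> < int p ^ (K * (l + 1))" using q'H l by linarith
        fix s assume s: "s < N"
        have "\<bar>r' s\<bar> \<le> H'" using H'le Hr[OF s] r'[OF s] by simp
        then show "\<bar>r' s\<bar> < int p ^ (K * (l + 1))" using l by linarith
      qed
      then obtain s where s: "s < N" "\<not> int p ^ a (Suc l) s dvd q' * x s (a (Suc l) s) - r' s"
        by blast
      let ?b = "j + a (Suc l) s"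
      let ?M = "real j + real (K * (l + N + 3))"
      have "\<not> int p ^ ?b dvd q * x s ?b - r s"
      proof
        assume "int p ^ ?b dvd q * x s ?b - r s"
        also have "q * x s ?b - r s = int p ^ j * (q' * x s ?b - r' s)"
          by (simp add: q'(1) r'[OF s(1)] algebra_simps)
        finally have "int p ^ a (Suc l) s dvd q' * x s ?b - r' s"
          using p1 by (simp add: power_add)
        moreover have "x s ?b mod int p ^ a (Suc l) s = x s (a (Suc l) s)"
          using x s(1) by (intro Zp_mod) (auto simp: ZpN_def)
        then have "int p ^ a (Suc l) s dvd x s ?b - x s (a (Suc l) s)"
          by (metis dvd_minus_mod)
        then have "int p ^ a (Suc l) s dvd q' * (x s ?b - x s (a (Suc l) s))" by simp
        ultimately have "int p ^ a (Suc l) s dvd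
            (q' * x s ?b - r' s) - q' * (x s ?b - x s (a (Suc l) s))"
          by (rule dvd_diff)
        then show False using s(2) by (simp add: algebra_simps)
      qed
      moreover have "real ?b - 1 \<le> ?M * (1 + i s)"
      proof -
        have "real j \<le> real j * (1 + i s)"
          using i[OF s(1)] by (simp add: algebra_simps)
        then show ?thesis
          using a[OF s(1), of l] by (simp add: distrib_right)
      qed
      moreover have "c * real p powr ?M \<le> H"
      proof -
        have "c * real p powr ?M = real p powr (real j + real (K * l))"
          unfolding c_def by (subst powr_add[symmetric]) (simp add: algebra_simps)
        also have "\<dots> = real_of_int (int p ^ j * int p ^ (K * l))"
          using p1 powr_realpow[of "real p" j] powr_realpow[of "real p" "K * l"]
          by (simp add: powr_add)
        also have "\<dots> \<le> real_of_int (int p ^ j * H')"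
          using l' p1 by (intro of_int_le_iff[THEN iffD2] mult_left_mono) auto
        also have "int p ^ j * H' \<le> H"
          using p1 by (simp add: H'_def mult.commute[of "int p ^ j"] minus_mod_eq_div_mult[symmetric])
        finally show ?thesis by simp
      qed
      ultimately show ?thesis using s(1) by blast
    qed
    then obtain s b M where s: "s < N" and b: "\<not> int p ^ b dvd q * x s b - r s"
      and M: "real b - 1 \<le> M * (1 + i s)" and cM: "c * real p powr M \<le> H" by blast
    have i0: "0 < 1 + i s" using i[OF s] by simp
    have "c * inverse H \<le> real p powr - M"
      using cM H0 p1 by (simp add: powr_minus field_simps)
    also have "\<dots> \<le> real p powr ((1 - real b) * (1 / (1 + i s)))"
      using M i0 p1 by (intro powr_mono) (auto simp: field_simps)
    also have "\<dots> = (real p powr (1 - real b)) powr (1 / (1 + i s))"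
      by (simp add: powr_powr)
    also have "\<dots> \<le> padic_abs_lin p q (x s) (r s) powr (1 / (1 + i s))"
      using padic_abs_lin_ge[of p b q "x s" "r s"] b p1 i0 by (intro powr_mono2) auto
    also have "\<dots> \<le> Max ((\<lambda>s. padic_abs_lin p q (x s) (r s) powr (1 / (1 + i s))) ` {..<N})"
      using s by (intro Max_ge) auto
    finally show ?thesis by (simp add: H_def)
  qed
  then show ?thesis using x c0 unfolding Bad_Zp_def by blast
qed

text \<open>The weights \<open>1 + i s\<close> add up to \<open>N + 1\<close>, so the exponents of a
  box add up to at least \<open>(N + 1) * K * (l + N + 2)\<close>. The shift \<open>N + 2\<close>
  makes \<open>K * (l + N + 2)\<close> exceed \<open>K * (l + 1) + N\<close>, as the pigeonhole
  argument requires for heights below \<open>p ^ (K * (l + 1))\<close>.\<close>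

definition side_exponent :: "(nat \<Rightarrow> real) \<Rightarrow> nat \<Rightarrow> nat \<Rightarrow> nat \<Rightarrow> nat \<Rightarrow> nat" where
  "side_exponent i N K l s = nat \<lceil>real (K * (l + N + 2)) * (1 + i s)\<rceil>"

lemma side_exponent_ge: "real (K * (l + N + 2)) * (1 + i s) \<le> real (side_exponent i N K l s)"
  unfolding side_exponent_def by linarith

lemma side_exponent_ge':
  assumes "0 \<le> i s"
  shows "K * (l + N + 2) \<le> side_exponent i N K l s"
proof -
  have "real (K * (l + N + 2)) * 1 \<le> real (K * (l + N + 2)) * (1 + i s)"
    using assms by (intro mult_left_mono) auto
  then show ?thesis
    using side_exponent_ge[of K l N i s] by linarith
qed

lemma side_exponent_le:
  assumes "0 \<le> i s"
  shows "real (side_exponent i N K l s) \<le> real (K * (l + N + 2)) * (1 + i s) + 1"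
proof -
  have "0 \<le> real (K * (l + N + 2)) * (1 + i s)" using assms by simp
  then show ?thesis unfolding side_exponent_def by linarith
qed

lemma side_exponent_less:
  assumes "0 \<le> i s" "0 < K"
  shows "side_exponent i N K l s < side_exponent i N K (Suc l) s"
proof -
  have "1 * 1 \<le> real K * (1 + i s)"
    using assms by (intro mult_mono) auto
  moreover have "real (K * (Suc l + N + 2)) * (1 + i s)
      = real (K * (l + N + 2)) * (1 + i s) + real K * (1 + i s)"
    by (simp add: algebra_simps)
  moreover have "0 \<le> real (K * (l + N + 2)) * (1 + i s)" using assms by simp
  ultimately show ?thesis unfolding side_exponent_def by linarith
qed

text \<open>The descent, with \<open>Good\<close> meaning free of rational points of height below
  \<open>p ^ (K * (l + 1))\<close>. The level \<open>k n div K + 1\<close> is deep enough for the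
  \<open>n\<close>-th ball because the exponents at level \<open>l\<close> are at least
  \<open>K * l\<close>.\<close>

lemma bad_point_avoiding_balls:
  fixes p N K :: nat and i :: "nat \<Rightarrow> real" and k :: "nat \<Rightarrow> nat" and c :: "nat \<Rightarrow> nat \<Rightarrow> int"
  assumes p: "prime p" and i: "\<And>s. s < N \<Longrightarrow> 0 \<le> i s" and i1: "(\<Sum>s<N. i s) = 1" and K: "0 < K"
    and small: "(\<Sum>n. ennreal (2 ^ (k n div K + 1) / real p ^ (N * k n)))
      < ennreal (1 / real p ^ (\<Sum>s<N. side_exponent i N K 0 s))"
  obtains x where "x \<in> Bad_Zp p N i" "\<And>n. \<exists>s<N. x s (k n) \<noteq> c n s"
proof -
  define a where "a = side_exponent i N K"
  have p1: "1 < p" using p prime_gt_1_nat by blast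
  have N: "0 < N" using i1 by (cases N) auto
  have aK: "K * (l + N + 2) \<le> a l s" if "s < N" for l s
    unfolding a_def using i[OF that] by (rule side_exponent_ge')
  have aless: "a l s < a (Suc l) s" if "s < N" for l s
    unfolding a_def using i[OF that] K by (rule side_exponent_less)
  have al: "l \<le> a l s" if "s < N" for l s
    using aK[OF that, of l] K by (intro order.trans[OF _ aK[OF that, of l]]) (cases K, auto)
  have ah: "K * (l + 1) + N \<le> a l s" if "s < N" for l s
  proof -
    have "K * (l + 1) + N \<le> K * (l + 1) + K * N" using K by simp
    also have "\<dots> \<le> K * (l + N + 2)" by (simp add: algebra_simps)
    finally show ?thesis using aK[OF that, of l] by simp
  qed
  have big: "Suc N * (K * (l + 1) + N) < (\<Sum>s<N. a l s)" for l
  proof -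
    have "real (Suc N * (K * (l + N + 2))) = (\<Sum>s<N. real (K * (l + N + 2)) * (1 + i s))"
      unfolding sum_distrib_left[symmetric] by (simp only: i1 sum.distrib) (simp add: algebra_simps)
    also have "\<dots> \<le> (\<Sum>s<N. real (a l s))"
      unfolding a_def by (intro sum_mono side_exponent_ge)
    finally have "Suc N * (K * (l + N + 2)) \<le> (\<Sum>s<N. a l s)"
      by (metis of_nat_le_iff of_nat_sum)
    moreover have "K * (l + 1) + N < K * (l + N + 2)"
    proof -
      have "N < K * (N + 1)" using K by (cases K) auto
      then show ?thesis by (simp add: algebra_simps)
    qed
    then have "Suc N * (K * (l + 1) + N) < Suc N * (K * (l + N + 2))"
      by (rule mult_less_mono2) simp
    ultimately show ?thesis by linarith
  qed
  define Good where "Good = (\<lambda>l (X :: nat \<Rightarrow> int). \<forall>q r. \<not> int p dvd q \<and> \<bar>q\<bar> < int p ^ (K * (l + 1)) \<and>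
      (\<forall>s<N. \<bar>r s\<bar> < int p ^ (K * (l + 1))) \<longrightarrow> (\<exists>s<N. \<not> int p ^ a (Suc l) s dvd q * X s - r s))"
  have many: "(\<Prod>s<N. p ^ (a (Suc l) s - a l s)) \<le>
      2 * card {Y \<in> PiE {..<N} (\<lambda>s. {0..<int p ^ (a (Suc l) s - a l s)}).
        Good l (\<lambda>s. X s + int p ^ a l s * Y s)}" for l X
    unfolding Good_def
    by (rule many_children_without_rational_points[OF p N ah big aless])
  have kL: "k n \<le> a (k n div K + 1) s" if "s < N" for n s
  proof -
    have "k n \<le> K * (k n div K + 1)"
      using K by (metis add.commute dividend_less_times_div less_imp_le mult_Suc_right plus_1_eq_Suc add_Suc)
    also have "\<dots> \<le> K * (k n div K + 1 + N + 2)" by (rule mult_left_mono) auto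
    finally show ?thesis using aK[OF that] order.trans by blast
  qed
  obtain X where X: "\<And>l. Good l (X (Suc l))"
    "\<And>l s. s < N \<Longrightarrow> int p ^ a l s dvd X (Suc l) s - X l s"
    "\<And>n. \<exists>s<N. \<not> int p ^ k n dvd X (k n div K + 1) s - c n s"
    by (rule good_branch_avoiding_balls[of p N a Good "\<lambda>n. k n div K + 1" k c])
      (use p1 aless many small kL in \<open>auto simp: a_def less_imp_le\<close>)
  obtain x where x: "x \<in> ZpN p N" "\<And>l s. s < N \<Longrightarrow> int p ^ a l s dvd x s (a l s) - X l s"
    by (rule limit_of_nested_boxes[of p N a X]) (use p1 aless al X(2) in \<open>auto simp: less_imp_le\<close>)
  have "x \<in> Bad_Zp p N i"
  proof (rule bad_if_avoids_rational_points[OF p N K i x(1)])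
    fix l s assume "s < N"
    then show "real (a (Suc l) s) \<le> real (K * (l + N + 3)) * (1 + i s) + 1"
      using side_exponent_le[of i s N K "Suc l"] i by (simp add: a_def add_ac eval_nat_numeral)
  next
    fix l q and r :: "nat \<Rightarrow> int"
    assume "\<not> int p dvd q" "\<bar>q\<bar> < int p ^ (K * (l + 1))" "\<And>s. s < N \<Longrightarrow> \<bar>r s\<bar> < int p ^ (K * (l + 1))"
    then obtain s where s: "s < N" "\<not> int p ^ a (Suc l) s dvd q * X (Suc l) s - r s"
      using X(1)[of l] unfolding Good_def by blast
    have "\<not> int p ^ a (Suc l) s dvd q * x s (a (Suc l) s) - r s"
    proof
      assume "int p ^ a (Suc l) s dvd q * x s (a (Suc l) s) - r s"
      then have "int p ^ a (Suc l) s dvd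
          (q * x s (a (Suc l) s) - r s) - q * (x s (a (Suc l) s) - X (Suc l) s)"
        by (rule dvd_diff[OF _ dvd_mult[OF x(2)[OF s(1)]]])
      then show False using s(2) by (simp add: algebra_simps)
    qed
    then show "\<exists>s<N. \<not> int p ^ a (Suc l) s dvd q * x s (a (Suc l) s) - r s" using s(1) by blast
  qed
  moreover have "\<exists>s<N. x s (k n) \<noteq> c n s" for n
  proof (rule ccontr)
    assume "\<not> ?thesis"
    then have eq: "x s (k n) = c n s" if "s < N" for s using that by blast
    let ?L = "k n div K + 1"
    have "int p ^ k n dvd X ?L s - c n s" if s: "s < N" for s
    proof -
      have "x s (a ?L s) mod int p ^ k n = c n s"
        using Zp_mod[of "x s" p "k n" "a ?L s"] x(1) s kL[OF s] eq[OF s] by (simp add: ZpN_def)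
      then have "int p ^ k n dvd x s (a ?L s) - c n s"
        by (metis dvd_minus_mod)
      moreover have "int p ^ k n dvd x s (a ?L s) - X ?L s"
        using x(2)[OF s] kL[OF s] by (rule power_le_dvd)
      ultimately have "int p ^ k n dvd (x s (a ?L s) - c n s) - (x s (a ?L s) - X ?L s)"
        by (rule dvd_diff)
      then show ?thesis by simp
    qed
    then show False using X(3)[of n] by blast
  qed
  ultimately show thesis by (rule that)
qed

subsection \<open>Hausdorff dimension\<close>

lemma ZpN_dist_le_diam:
  assumes "0 < p" "0 < N" "x \<in> C" "y \<in> C"
  shows "ZpN_dist p N x y \<le> diam_d (ZpN_dist p N) C"
proof -
  have "bdd_above {ZpN_dist p N x y | x y. x \<in> C \<and> y \<in> C}"
    using ZpN_dist_bounds(2)[OF assms(1,2)] by (intro bdd_aboveI[of _ 1]) auto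
  then show ?thesis
    unfolding diam_d_def using assms(3,4) by (auto intro!: cSup_upper)
qed

lemma diam_ZpN_le:
  assumes "0 \<le> b" "\<And>x y. x \<in> C \<Longrightarrow> y \<in> C \<Longrightarrow> ZpN_dist p N x y \<le> b"
  shows "diam_d (ZpN_dist p N) C \<le> b"
proof (cases "C = {}")
  case False
  then have "{ZpN_dist p N x y | x y. x \<in> C \<and> y \<in> C} \<noteq> {}" by blast
  then have "Sup {ZpN_dist p N x y | x y. x \<in> C \<and> y \<in> C} \<le> b"
    by (rule cSup_least) (use assms(2) in auto)
  then show ?thesis using False by (simp add: diam_d_def)
qed (simp add: diam_d_def assms(1))

lemma diam_pow_nonneg: "0 \<le> diam_pow d s C"
  by (simp add: diam_pow_def)

text \<open>One doubling per \<open>K\<close> digits costs at most \<open>p powr (k / K)\<close>,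
  and the choice of \<open>K\<close> keeps this within the gap between \<open>N\<close> and
  \<open>\<tau>\<close>.\<close>

lemma ball_cost_le:
  fixes p N K k :: nat and \<tau> :: real
  assumes p: "2 \<le> p" and K: "0 < K" "1 / real K \<le> real N - \<tau>"
  shows "2 ^ (k div K + 1) / real p ^ (N * k) \<le> 2 * real p powr (- real k * \<tau>)"
proof -
  have "(2::real) ^ (k div K) \<le> real p ^ (k div K)"
    using p by (intro power_mono) auto
  also have "\<dots> = real p powr real (k div K)"
    using p by (simp add: powr_realpow)
  also have "\<dots> \<le> real p powr (real k * (1 / real K))"
    using p K(1) times_div_less_eq_dividend[of K k]
    by (intro powr_mono) (auto simp: field_simps simp flip: of_nat_mult)
  also have "\<dots> \<le> real p powr (real k * (real N - \<tau>))"
    using p K by (intro powr_mono mult_left_mono) auto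
  finally have "2 ^ (k div K) / real p ^ (N * k) \<le> real p powr (real k * (real N - \<tau>)) / real p ^ (N * k)"
    by (rule divide_right_mono) simp
  also have "\<dots> = real p powr (real k * (real N - \<tau>)) / real p powr (real N * real k)"
    using p by (simp flip: powr_realpow)
  also have "\<dots> = real p powr (- real k * \<tau>)"
    by (simp add: powr_diff[symmetric] algebra_simps)
  finally show ?thesis by simp
qed

text \<open>Take \<open>k\<close> maximal such that all points of \<open>C\<close> agree modulo
  \<open>p ^ k\<close>; two of them are then at distance at least \<open>p powr - k\<close>. If
  \<open>C\<close> has at most one point there is no maximal \<open>k\<close> and
  \<open>diam_pow\<close> may be 0; there \<open>\<epsilon>\<close> bounds the cost of a very small
  ball, which tends to 0 because \<open>\<tau>\<close> is positive.\<close>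

lemma enclosing_ball_exists:
  fixes p N K :: nat and \<sigma> \<tau> \<epsilon> :: real
  assumes p: "2 \<le> p" and N: "0 < N" and \<tau>: "0 \<le> \<sigma>" "\<sigma> \<le> \<tau>" "0 < \<tau>"
    and K: "0 < K" "1 / real K \<le> real N - \<tau>" and \<epsilon>: "0 < \<epsilon>" and C: "C \<subseteq> ZpN p N"
  obtains k c where "\<And>x s. x \<in> C \<Longrightarrow> s < N \<Longrightarrow> x s k = c s"
    "2 ^ (k div K + 1) / real p ^ (N * k) \<le> 2 * diam_pow (ZpN_dist p N) \<sigma> C + \<epsilon>"
proof (cases "\<exists>x\<in>C. \<exists>y\<in>C. x \<noteq> y")
  case False
  have "real p powr - \<tau> < 1" "0 < real p powr - \<tau>"
    using p \<tau>(3) by (auto simp: powr_less_one)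
  then obtain k where "(real p powr - \<tau>) ^ k < \<epsilon> / 2"
    using real_arch_pow_inv[of "\<epsilon> / 2" "real p powr - \<tau>"] \<epsilon> by auto
  then have "real p powr (- real k * \<tau>) < \<epsilon> / 2"
    using p by (simp add: powr_powr powr_realpow[symmetric] mult.commute)
  then have "2 ^ (k div K + 1) / real p ^ (N * k) \<le> \<epsilon>"
    using ball_cost_le[OF p K, of k] by linarith
  also have "\<dots> \<le> 2 * diam_pow (ZpN_dist p N) \<sigma> C + \<epsilon>"
    by (simp add: diam_pow_nonneg)
  finally have cost: "2 ^ (k div K + 1) / real p ^ (N * k) \<le> 2 * diam_pow (ZpN_dist p N) \<sigma> C + \<epsilon>" .
  \<comment> \<open>The only point of \<open>C\<close> is the centre; for empty \<open>C\<close> the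
    claim is vacuous.\<close>
  have "x s k = (SOME x. x \<in> C) s k" if "x \<in> C" for x s
  proof -
    have "(SOME x. x \<in> C) \<in> C" using that by (auto simp: some_in_eq)
    then have "x = (SOME x. x \<in> C)" using False that by blast
    then show ?thesis by simp
  qed
  then show thesis
    by (rule that[of k "\<lambda>s. (SOME x. x \<in> C) s k", OF _ cost])
next
  case True
  define P where "P = (\<lambda>k. \<exists>x\<in>C. \<exists>y\<in>C. \<exists>s<N. x s (Suc k) \<noteq> y s (Suc k))"
  \<comment> \<open>Residues modulo \<open>p ^ 0\<close> never differ, so every disagreement sits at
    some level \<open>Suc k\<close>, as \<open>P\<close> presumes.\<close>
  have zero: "x s 0 = 0" if "x \<in> C" "s < N" for x s
  proof -
    have "x s \<in> Zp p" using that C by (auto simp: ZpN_def)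
    then have "0 \<le> x s 0 \<and> x s 0 < int p ^ 0" unfolding Zp_def by blast
    then show ?thesis by simp
  qed
  obtain x y where xy: "x \<in> C" "y \<in> C" "x \<noteq> y" using True by blast
  then obtain s k0 where s: "x s k0 \<noteq> y s k0" by fastforce
  have "x \<in> ZpN p N" "y \<in> ZpN p N" using xy C by auto
  then have sN: "s < N"
    using s by (cases "s < N") (auto simp: ZpN_def not_less)
  then have "k0 \<noteq> 0" using s zero xy by metis
  then have ex: "P (k0 - 1)" using s sN xy by (auto simp: P_def)
  define k where "k = (LEAST k. P k)"
  have "P k" unfolding k_def using ex by (rule LeastI)
  then obtain u v t where uv: "u \<in> C" "v \<in> C" "t < N" "u t (Suc k) \<noteq> v t (Suc k)"
    by (auto simp: P_def)
  have agree: "z s k = x s k" if "z \<in> C" "s < N" for z s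
  proof (cases k)
    case 0
    then show ?thesis using zero[OF that] zero[OF xy(1) that(2)] by simp
  next
    case (Suc k')
    then have "\<not> P k'" using not_less_Least[of k' P] by (simp add: k_def)
    then show ?thesis using that xy(1) Suc by (auto simp: P_def)
  qed
  have "real p powr - real k \<le> ZpN_dist p N u v"
    using uv p C by (intro ZpN_dist_ge[of p t]) auto
  also have "\<dots> \<le> diam_d (ZpN_dist p N) C"
    using uv p N by (intro ZpN_dist_le_diam) auto
  finally have diam: "real p powr - real k \<le> diam_d (ZpN_dist p N) C" .
  have "0 < diam_d (ZpN_dist p N) C"
    using p by (intro less_le_trans[OF _ diam]) auto
  then have pow: "diam_pow (ZpN_dist p N) \<sigma> C = diam_d (ZpN_dist p N) C powr \<sigma>"
    using xy(1) by (auto simp: diam_pow_def)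
  have "2 ^ (k div K + 1) / real p ^ (N * k) \<le> 2 * real p powr (- real k * \<tau>)"
    by (rule ball_cost_le[OF p K])
  also have "\<dots> \<le> 2 * real p powr (- real k * \<sigma>)"
    using p mult_left_mono[OF \<tau>(2), of "real k"] by (auto intro!: mult_left_mono[OF powr_mono])
  also have "\<dots> = 2 * (real p powr - real k) powr \<sigma>"
    by (simp add: powr_powr)
  also have "\<dots> \<le> 2 * diam_pow (ZpN_dist p N) \<sigma> C"
    unfolding pow using diam \<tau>(1) by (intro mult_left_mono powr_mono2) auto
  finally show thesis
    by (intro that[of k "\<lambda>s. x s k"] agree) (use \<epsilon> in auto)
qed

lemma hausdorff_measure_Bad_nonzero:
  fixes p N :: nat and i :: "nat \<Rightarrow> real" and \<sigma> :: real
  assumes p: "prime p" and i: "\<And>s. s < N \<Longrightarrow> 0 \<le> i s" and i1: "(\<Sum>s<N. i s) = 1"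
    and \<sigma>: "0 \<le> \<sigma>" "\<sigma> < real N"
  shows "hausdorff_measure (ZpN p N) (ZpN_dist p N) \<sigma> (Bad_Zp p N i) \<noteq> 0"
proof
  let ?d = "ZpN_dist p N"
  assume zero: "hausdorff_measure (ZpN p N) ?d \<sigma> (Bad_Zp p N i) = 0"
  have p2: "2 \<le> p" using p prime_ge_2_nat by blast
  have N: "0 < N" using i1 by (cases N) auto
  \<comment> \<open>The midpoint leaves room on both sides: \<open>\<sigma> \<le> \<tau>\<close> for
    comparing with diameters, \<open>\<tau> < N\<close> for choosing \<open>K\<close>; it is
    positive even when \<open>\<sigma>\<close> is 0.\<close>
  define \<tau> where "\<tau> = (\<sigma> + real N) / 2"
  have \<tau>: "\<sigma> \<le> \<tau>" "0 < \<tau>" "\<tau> < real N" using \<sigma> N by (auto simp: \<tau>_def)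
  obtain K0 where "inverse (real (Suc K0)) < real N - \<tau>"
    using reals_Archimedean[of "real N - \<tau>"] \<tau>(3) by auto
  then obtain K where K: "0 < K" "1 / real K \<le> real N - \<tau>"
    by (intro that[of "Suc K0"]) (auto simp: inverse_eq_divide)
  \<comment> \<open>The doubled cost of the cover and the geometric error terms add up to at most
    \<open>4 * \<eta>\<close>, half the volume of the starting box.\<close>
  define \<eta> where "\<eta> = 1 / real p ^ (\<Sum>s<N. side_exponent i N K 0 s) / 8"
  have \<eta>: "0 < \<eta>" using p2 by (simp add: \<eta>_def)
  have "hausdorff_content (ZpN p N) ?d \<sigma> 1 (Bad_Zp p N i)
      \<le> hausdorff_measure (ZpN p N) ?d \<sigma> (Bad_Zp p N i)"
    unfolding hausdorff_measure_def by (rule SUP_upper) simp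
  then have "hausdorff_content (ZpN p N) ?d \<sigma> 1 (Bad_Zp p N i) < ennreal \<eta>"
    using zero \<eta> by simp
  then obtain C where C: "\<And>n. C n \<subseteq> ZpN p N" "Bad_Zp p N i \<subseteq> (\<Union>n. C n)"
    "(\<Sum>n. ennreal (diam_pow ?d \<sigma> (C n))) < ennreal \<eta>"
    unfolding hausdorff_content_def INF_less_iff by blast
  have "\<exists>k c. (\<forall>x\<in>C n. \<forall>s<N. x s k = c s) \<and>
      2 ^ (k div K + 1) / real p ^ (N * k) \<le> 2 * diam_pow ?d \<sigma> (C n) + \<eta> * (1 / 2) ^ n" for n
    by (rule enclosing_ball_exists[OF p2 N \<sigma>(1) \<tau>(1,2) K _ C(1)[of n], of "\<eta> * (1 / 2) ^ n"])
      (use \<eta> in auto)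
  then obtain k c where kc: "\<And>n x s. x \<in> C n \<Longrightarrow> s < N \<Longrightarrow> x s (k n) = c n s"
    "\<And>n. 2 ^ (k n div K + 1) / real p ^ (N * k n) \<le> 2 * diam_pow ?d \<sigma> (C n) + \<eta> * (1 / 2) ^ n"
    by metis
  have geo: "(\<Sum>n. ennreal (\<eta> * (1 / 2) ^ n)) = ennreal (2 * \<eta>)"
    using \<eta> sums_mult[OF geometric_sums[of "1 / 2 :: real"], of \<eta>]
    by (intro suminf_ennreal_eq) (auto simp: mult.commute)
  have "(\<Sum>n. ennreal (2 ^ (k n div K + 1) / real p ^ (N * k n)))
      \<le> (\<Sum>n. 2 * ennreal (diam_pow ?d \<sigma> (C n)) + ennreal (\<eta> * (1 / 2) ^ n))"
  proof (intro suminf_le summableI)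
    fix n
    have "ennreal (2 ^ (k n div K + 1) / real p ^ (N * k n))
        \<le> ennreal (2 * diam_pow ?d \<sigma> (C n) + \<eta> * (1 / 2) ^ n)"
      by (rule ennreal_leI[OF kc(2)])
    also have "\<dots> = 2 * ennreal (diam_pow ?d \<sigma> (C n)) + ennreal (\<eta> * (1 / 2) ^ n)"
      using \<eta> by (simp add: ennreal_plus ennreal_mult diam_pow_nonneg)
    finally show "ennreal (2 ^ (k n div K + 1) / real p ^ (N * k n))
        \<le> 2 * ennreal (diam_pow ?d \<sigma> (C n)) + ennreal (\<eta> * (1 / 2) ^ n)" .
  qed
  also have "\<dots> = 2 * (\<Sum>n. ennreal (diam_pow ?d \<sigma> (C n))) + (\<Sum>n. ennreal (\<eta> * (1 / 2) ^ n))"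
    by (subst suminf_add[symmetric]) (auto simp: ennreal_suminf_cmult)
  also have "\<dots> \<le> 2 * ennreal \<eta> + ennreal (2 * \<eta>)"
    unfolding geo using C(3) by (intro add_right_mono mult_left_mono) auto
  also have "\<dots> = ennreal (4 * \<eta>)"
    using \<eta> by (simp add: ennreal_mult flip: distrib_right)
  also have "\<dots> < ennreal (1 / real p ^ (\<Sum>s<N. side_exponent i N K 0 s))"
    using \<eta> p2 by (intro ennreal_lessI) (auto simp: \<eta>_def field_simps)
  finally have "(\<Sum>n. ennreal (2 ^ (k n div K + 1) / real p ^ (N * k n)))
      < ennreal (1 / real p ^ (\<Sum>s<N. side_exponent i N K 0 s))" .
  from bad_point_avoiding_balls[of p N i K k c, OF p i i1 K(1) this]
  obtain x where x: "x \<in> Bad_Zp p N i" "\<And>n. \<exists>s<N. x s (k n) \<noteq> c n s"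
    by metis
  then obtain n where "x \<in> C n" using C(2) by auto
  then show False using x(2)[of n] kc(1) by blast
qed

text \<open>The \<open>p ^ (N * k)\<close> residue classes modulo \<open>p ^ k\<close> have diameter
  at most \<open>p powr - k\<close>, so they cover at total cost at most
  \<open>p powr (k * (N - \<sigma>))\<close>, which tends to 0.\<close>

lemma hausdorff_measure_eq_0:
  fixes p N :: nat and \<sigma> :: real
  assumes p: "2 \<le> p" and N: "0 < N" and \<sigma>: "real N < \<sigma>" and E: "E \<subseteq> ZpN p N"
  shows "hausdorff_measure (ZpN p N) (ZpN_dist p N) \<sigma> E = 0"
proof -
  let ?d = "ZpN_dist p N"
  have small: "hausdorff_content (ZpN p N) ?d \<sigma> \<delta> E \<le> ennreal \<epsilon>" if \<delta>: "0 < \<delta>" and \<epsilon>: "0 < \<epsilon>" for \<delta> \<epsilon> :: real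
  proof -
    have q: "real p powr (real N - \<sigma>) < 1" "0 < real p powr (real N - \<sigma>)"
      "1 / real p < 1" "0 < 1 / real p"
      using p \<sigma> by (auto simp: powr_less_one)
    \<comment> \<open>\<open>k1\<close> makes the total cost small, \<open>k2\<close> the diameters;
      both improve as \<open>k\<close> grows, so the maximum serves.\<close>
    then obtain k1 k2 where k12: "(real p powr (real N - \<sigma>)) ^ k1 < \<epsilon>" "(1 / real p) ^ k2 < \<delta>"
      using real_arch_pow_inv[OF \<epsilon> q(1)] real_arch_pow_inv[OF \<delta> q(3)] by blast
    define k where "k = max k1 k2"
    have k: "(real p powr (real N - \<sigma>)) ^ k < \<epsilon>" "(1 / real p) ^ k < \<delta>"
    proof -
      have "(real p powr (real N - \<sigma>)) ^ k \<le> (real p powr (real N - \<sigma>)) ^ k1"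
        "(1 / real p) ^ k \<le> (1 / real p) ^ k2"
        using q by (intro power_decreasing; simp add: k_def)+
      then show "(real p powr (real N - \<sigma>)) ^ k < \<epsilon>" "(1 / real p) ^ k < \<delta>"
        using k12 by linarith+
    qed
    have pk: "real p powr - real k = (1 / real p) ^ k"
      using p by (simp add: powr_minus powr_realpow power_one_over divide_inverse power_inverse)
    define S where "S = PiE {..<N} (\<lambda>_. {0..<int p ^ k})"
    have cardS: "card S = p ^ (N * k)"
      by (simp add: S_def card_PiE nat_power_eq power_mult[symmetric] mult.commute)
    have "finite S" by (auto simp: S_def intro: finite_PiE)
    then obtain f where f: "bij_betw f {0..<card S} S"
      using ex_bij_betw_nat_finite by blast
    \<comment> \<open>The finite cover is continued by empty sets, whose \<open>diam_pow\<close> is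
      0.\<close>
    define C where "C = (\<lambda>n. if n < card S then {x \<in> ZpN p N. \<forall>s<N. x s k = f n s} else {})"
    have diam: "diam_d ?d (C n) \<le> (1 / real p) ^ k" for n
      unfolding pk[symmetric]
    proof (rule diam_ZpN_le)
      fix x y assume "x \<in> C n" "y \<in> C n"
      then show "ZpN_dist p N x y \<le> real p powr - real k"
        using p N by (intro ZpN_dist_le) (auto simp: C_def split: if_splits)
    qed auto
    have diam0: "0 \<le> diam_d ?d (C n)" for n
    proof (cases "C n = {}")
      case False
      then obtain x where "x \<in> C n" by blast
      then show ?thesis
        using ZpN_dist_bounds(1)[of p N x x] ZpN_dist_le_diam[of p N x "C n" x] p N by fastforce
    qed (simp add: diam_d_def)
    have cost: "diam_pow ?d \<sigma> (C n) \<le> ((1 / real p) ^ k) powr \<sigma>" for n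
      using diam[of n] diam0[of n] \<sigma> by (auto simp: diam_pow_def intro!: powr_mono2)
    have "E \<subseteq> (\<Union>n. C n)"
    proof
      fix x assume "x \<in> E"
      then have x: "x \<in> ZpN p N" using E by blast
      then have "restrict (\<lambda>s. x s k) {..<N} \<in> S"
        by (auto simp: S_def ZpN_def Zp_def)
      then have "restrict (\<lambda>s. x s k) {..<N} \<in> f ` {0..<card S}"
        using f by (simp add: bij_betw_def)
      then obtain n where n: "n < card S" "restrict (\<lambda>s. x s k) {..<N} = f n"
        by (elim imageE) auto
      then have "x \<in> C n" using x by (simp add: C_def flip: n(2))
      then show "x \<in> (\<Union>n. C n)" by blast
    qed
    moreover have "C n \<subseteq> ZpN p N \<and> diam_d ?d (C n) \<le> \<delta>" for n
      using diam[of n] k(2) by (auto simp: C_def)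
    ultimately have "hausdorff_content (ZpN p N) ?d \<sigma> \<delta> E \<le> (\<Sum>n. ennreal (diam_pow ?d \<sigma> (C n)))"
      unfolding hausdorff_content_def by (intro INF_lower) blast
    also have "\<dots> = (\<Sum>n<card S. ennreal (diam_pow ?d \<sigma> (C n)))"
      by (intro suminf_finite) (auto simp: C_def diam_pow_def)
    also have "\<dots> \<le> (\<Sum>n<card S. ennreal (((1 / real p) ^ k) powr \<sigma>))"
      by (intro sum_mono ennreal_leI cost)
    also have "\<dots> = ennreal (real (card S) * ((1 / real p) ^ k) powr \<sigma>)"
      by (simp add: ennreal_mult ennreal_of_nat_eq_real_of_nat)
    also have "real (card S) * ((1 / real p) ^ k) powr \<sigma> = (real p powr (real N - \<sigma>)) ^ k"
    proof -
      have "real (card S) = real p powr (real N * real k)"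
        using p by (simp add: cardS powr_realpow[symmetric])
      then have "real (card S) * ((1 / real p) ^ k) powr \<sigma> = real p powr (real N * real k + - real k * \<sigma>)"
        unfolding pk[symmetric] powr_add by (simp add: powr_powr)
      also have "\<dots> = (real p powr (real N - \<sigma>)) powr real k"
        by (simp add: powr_powr algebra_simps)
      finally show ?thesis using p by (simp add: powr_realpow)
    qed
    finally show ?thesis
      using k(1) by (meson ennreal_leI less_imp_le order.trans)
  qed
  have "hausdorff_content (ZpN p N) ?d \<sigma> \<delta> E = 0" if "0 < \<delta>" for \<delta> :: real
  proof -
    have "hausdorff_content (ZpN p N) ?d \<sigma> \<delta> E \<le> 0"
      by (rule ennreal_le_epsilon) (simp add: small[OF that])
    then show ?thesis by simp
  qed
  then show ?thesis
    unfolding hausdorff_measure_def by (intro antisym SUP_least) auto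
qed

theorem theorem10:
  fixes p N :: nat and i :: "nat \<Rightarrow> real"
  assumes "prime p"
    and "\<forall>s<N. 0 \<le> i s"
    and "(\<Sum>s<N. i s) = 1"
  shows "hausdorff_dim (ZpN p N) (ZpN_dist p N) (Bad_Zp p N i) = ereal (real N)"
proof -
  let ?\<mu> = "\<lambda>s. hausdorff_measure (ZpN p N) (ZpN_dist p N) s (Bad_Zp p N i)"
  have N: "0 < N" using assms(3) by (cases N) auto
  have sub: "Bad_Zp p N i \<subseteq> ZpN p N" by (auto simp: Bad_Zp_def)
  have lower: "ereal (real N) \<le> ereal s" if "0 \<le> s" "?\<mu> s = 0" for s
  proof -
    have "\<not> s < real N"
      using hausdorff_measure_Bad_nonzero[OF assms(1) _ assms(3) that(1)] assms(2) that(2) by auto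
    then show ?thesis by simp
  qed
  \<comment> \<open>The measure is shown to vanish only strictly above \<open>N\<close>, so
    \<open>N\<close> is approached through \<open>N + e\<close>.\<close>
  have upper: "(INF s\<in>{s. 0 \<le> s \<and> ?\<mu> s = 0}. ereal s) \<le> ereal (real N) + ereal e" if "0 < e" for e
  proof -
    have "?\<mu> (real N + e) = 0"
      using hausdorff_measure_eq_0[OF prime_ge_2_nat[OF assms(1)] N _ sub] that by simp
    then have "(INF s\<in>{s. 0 \<le> s \<and> ?\<mu> s = 0}. ereal s) \<le> ereal (real N + e)"
      using that by (intro INF_lower) simp
    then show ?thesis by simp
  qed
  show ?thesis
    unfolding hausdorff_dim_def
  proof (rule antisym)
    show "(INF s\<in>{s. 0 \<le> s \<and> ?\<mu> s = 0}. ereal s) \<le> ereal (real N)"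
      by (rule ereal_le_epsilon2) (use upper in simp)
    show "ereal (real N) \<le> (INF s\<in>{s. 0 \<le> s \<and> ?\<mu> s = 0}. ereal s)"
      by (rule INF_greatest) (use lower in simp)
  qed
qed

end
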